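(* Every solution $(x(z),y(z))$ of the first Painlevé equation $$\frac{dx}{dz} = 6y^2+z,\qquad \frac{dy}{dz}=x$$ is meromorphic on $\mathbb{C}$; that is, every local holomorphic solution extends to a pair of meromorphic functions on the whole of $\mathbb{C}$.
   Context: The variables $x,y,z$ are complex. A solution is the one determined by an arbitrary initial condition $(x(z_0),y(z_0))=(x_0,y_0)\in\mathbb{C}^2$ at an arbitrary $z_0\in\mathbb{C}$. *)

theory Defs
  imports "HOL-Complex_Analysis.Complex_Analysis"
begin

definition painleve1_solution_on ::
  "complex set \<Rightarrow> (complex \<Rightarrow> complex) \<Rightarrow> (complex \<Rightarrow> complex) \<Rightarrow> bool" where
  "painleve1_solution_on U x y \<longleftrightarrow>
     x holomorphic_on U \<and> y holomorphic_on U \<and>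
     (\<forall>z\<in>U. (x has_field_derivative 6 * (y z)\<^sup>2 + z) (at z) \<and>
            (y has_field_derivative x z) (at z))"

definition regular_points :: "(complex \<Rightarrow> complex) \<Rightarrow> (complex \<Rightarrow> complex) \<Rightarrow> complex set" where
  "regular_points x y = {z. \<not> is_pole x z \<and> \<not> is_pole y z}"

text \<open>
  The predicate \<open>meromorphic_on\<close> ignores the values of a function at isolated points. Requiring the
  differential equations at all points of \<open>regular_points\<close> rules out removable singularities with
  a wrong value; only the values at actual poles stay unspecified.
\<close>

definition painleve1_meromorphic_solution ::
  "(complex \<Rightarrow> complex) \<Rightarrow> (complex \<Rightarrow> complex) \<Rightarrow> bool" where
  "painleve1_meromorphic_solution x y \<longleftrightarrow>
     x meromorphic_on UNIV \<and> y meromorphic_on UNIV \<and>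
     painleve1_solution_on (regular_points x y) x y"

end

theory Submission
  imports Defs
begin

text \<open>
  The Hamiltonian satisfies \<open>(x\<^sup>2 - 4 y\<^sup>3 - 2 z y)' = - 2 y\<close>, and adding \<open>x / y\<close> makes it finite at
  the poles of \<open>y\<close>. The classical difficulty with \<open>x\<^sup>2 - 4 y\<^sup>3 - 2 z y + x / y\<close> is that it blows up at
  the zeros of \<open>y\<close>, which forces detours around them. Here \<open>1 / y\<close> is replaced by the smooth,
  non-holomorphic function \<open>cnj y / (1 + \<bar>y\<bar>\<^sup>2)\<close>: the resulting energy \<open>W\<close> satisfies
  \<open>\<bar>dW/ds\<bar> \<le> A (1 + \<bar>W\<bar>)\<close> along every straight segment free of poles. Almost every radius of a disc avoids the poles, so by
  Gronwall \<open>W\<close> is bounded along points that approach any given boundary point.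

  A bound on \<open>W\<close> gives a uniform radius of meromorphic continuation: if \<open>y\<close> is bounded then so is \<open>x\<close>,
  and Picard iteration applies directly; if \<open>y\<close> is large, put \<open>y = 1 / u\<^sup>2\<close> and
  \<open>x = - 2 / u\<^sup>3 - z u / 2 - u\<^sup>2 / 2 + v u\<^sup>3\<close>, which turns the equation into a polynomial system for
  \<open>(u, v)\<close> with bounded data, whose solutions have simple zeros of \<open>u\<close>, that is, poles of \<open>(x, y)\<close>.
  Hence a solution on a disc always extends to a larger concentric disc.
\<close>

subsection \<open>Polynomial systems of two complex differential equations\<close>

text \<open>Built only from constants, variables, sums and products, so that holomorphy and
  Lipschitz bounds follow by induction, for the Painleve system and for the chart at a pole
  alike.\<close>

inductive poly3 :: "(complex \<Rightarrow> complex \<Rightarrow> complex \<Rightarrow> complex) \<Rightarrow> bool" where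
  poly3_const: "poly3 (\<lambda>z u v. c)"
| poly3_z: "poly3 (\<lambda>z u v. z)"
| poly3_u: "poly3 (\<lambda>z u v. u)"
| poly3_v: "poly3 (\<lambda>z u v. v)"
| poly3_add: "poly3 f \<Longrightarrow> poly3 g \<Longrightarrow> poly3 (\<lambda>z u v. f z u v + g z u v)"
| poly3_mult: "poly3 f \<Longrightarrow> poly3 g \<Longrightarrow> poly3 (\<lambda>z u v. f z u v * g z u v)"

lemma poly3_power: "poly3 f \<Longrightarrow> poly3 (\<lambda>z u v. f z u v ^ n)"
  by (induction n) (auto intro: poly3.intros)

lemma poly3_holomorphic:
  assumes "poly3 f" "u holomorphic_on S" "v holomorphic_on S"
  shows "(\<lambda>z. f z (u z) (v z)) holomorphic_on S"
  using assms by (induction rule: poly3.induct) (auto intro!: holomorphic_intros)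

text \<open>Size and variation have to be estimated together: in the induction step for a product,
  the variation of one factor is multiplied by the size of the other.\<close>

lemma poly3_lipschitz:
  assumes "poly3 f"
  shows "\<exists>K>0. \<forall>z u v u' v'. norm z \<le> M \<and> norm u \<le> M \<and> norm v \<le> M \<and> norm u' \<le> M \<and> norm v' \<le> M \<longrightarrow>
           norm (f z u v) \<le> K \<and> norm (f z u v - f z u' v') \<le> K * (norm (u - u') + norm (v - v'))"
  using assms
proof (induction rule: poly3.induct)
  case (poly3_const c)
  show ?case by (rule exI[of _ "norm c + 1"]) (auto simp: add_pos_nonneg add_nonneg_pos)
next
  case poly3_z
  show ?case by (rule exI[of _ "\<bar>M\<bar> + 1"]) auto
next
  case poly3_u
  have "a \<le> (\<bar>M\<bar> + 1) * (a + b)" if "a \<ge> 0" "b \<ge> 0" for a b :: real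
    using mult_right_mono[of 1 "\<bar>M\<bar> + 1" "a + b"] that by auto
  then show ?case by (intro exI[of _ "\<bar>M\<bar> + 1"]) auto
next
  case poly3_v
  have "a \<le> (\<bar>M\<bar> + 1) * (b + a)" if "a \<ge> 0" "b \<ge> 0" for a b :: real
    using mult_right_mono[of 1 "\<bar>M\<bar> + 1" "a + b"] that by (auto simp: add.commute)
  then show ?case by (intro exI[of _ "\<bar>M\<bar> + 1"]) auto
next
  case (poly3_add f g)
  then obtain K L where K: "K > 0" "L > 0"
    and f: "\<And>z u v u' v'. norm z \<le> M \<and> norm u \<le> M \<and> norm v \<le> M \<and> norm u' \<le> M \<and> norm v' \<le> M \<Longrightarrow>
           norm (f z u v) \<le> K \<and> norm (f z u v - f z u' v') \<le> K * (norm (u - u') + norm (v - v'))"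
    and g: "\<And>z u v u' v'. norm z \<le> M \<and> norm u \<le> M \<and> norm v \<le> M \<and> norm u' \<le> M \<and> norm v' \<le> M \<Longrightarrow>
           norm (g z u v) \<le> L \<and> norm (g z u v - g z u' v') \<le> L * (norm (u - u') + norm (v - v'))"
    by metis
  show ?case
  proof (intro exI[of _ "K + L"] conjI allI impI)
    fix z u v u' v' :: complex
    assume a: "norm z \<le> M \<and> norm u \<le> M \<and> norm v \<le> M \<and> norm u' \<le> M \<and> norm v' \<le> M"
    show "norm (f z u v + g z u v) \<le> K + L"
      using f[OF a] g[OF a] norm_triangle_mono by blast
    have "f z u v + g z u v - (f z u' v' + g z u' v') = (f z u v - f z u' v') + (g z u v - g z u' v')"
      by simp
    then show "norm (f z u v + g z u v - (f z u' v' + g z u' v')) \<le> (K + L) * (norm (u - u') + norm (v - v'))"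
      using f[OF a] g[OF a] norm_triangle_mono unfolding distrib_right[of K L] by metis
  qed (use K in auto)
next
  case (poly3_mult f g)
  then obtain K L where K: "K > 0" "L > 0"
    and f: "\<And>z u v u' v'. norm z \<le> M \<and> norm u \<le> M \<and> norm v \<le> M \<and> norm u' \<le> M \<and> norm v' \<le> M \<Longrightarrow>
           norm (f z u v) \<le> K \<and> norm (f z u v - f z u' v') \<le> K * (norm (u - u') + norm (v - v'))"
    and g: "\<And>z u v u' v'. norm z \<le> M \<and> norm u \<le> M \<and> norm v \<le> M \<and> norm u' \<le> M \<and> norm v' \<le> M \<Longrightarrow>
           norm (g z u v) \<le> L \<and> norm (g z u v - g z u' v') \<le> L * (norm (u - u') + norm (v - v'))"
    by metis
  show ?case
  \<comment> \<open>\<open>K * L\<close> bounds the product itself; its variation costs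
    \<open>2 * K * L\<close>, one \<open>K * L\<close> for each factor that is exchanged.\<close>
  proof (intro exI[of _ "K * L + 2 * K * L"] conjI allI impI)
    fix z u v u' v' :: complex
    assume a: "norm z \<le> M \<and> norm u \<le> M \<and> norm v \<le> M \<and> norm u' \<le> M \<and> norm v' \<le> M"
    then have a': "norm z \<le> M \<and> norm u' \<le> M \<and> norm v' \<le> M \<and> norm u \<le> M \<and> norm v \<le> M" by blast
    have "norm (f z u v * g z u v) \<le> K * L"
      unfolding norm_mult using f[OF a] g[OF a] K by (intro mult_mono) auto
    then show "norm (f z u v * g z u v) \<le> K * L + 2 * K * L"
      using K by (smt (verit) mult_pos_pos)
    define d where "d = norm (u - u') + norm (v - v')"
    have "d \<ge> 0" unfolding d_def by simp
    have "f z u v * g z u v - f z u' v' * g z u' v' =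
        f z u v * (g z u v - g z u' v') + (f z u v - f z u' v') * g z u' v'"
      by (simp add: algebra_simps)
    also have "norm \<dots> \<le> K * (L * d) + (K * d) * L"
      using f[OF a] g[OF a] g[OF a'] K \<open>d \<ge> 0\<close> unfolding d_def
      by (intro order_trans[OF norm_triangle_ineq] add_mono; unfold norm_mult; intro mult_mono) auto
    also have "\<dots> \<le> (K * L + 2 * K * L) * d"
      using K \<open>d \<ge> 0\<close> by (simp add: algebra_simps)
    finally show "norm (f z u v * g z u v - f z u' v' * g z u' v')
        \<le> (K * L + 2 * K * L) * (norm (u - u') + norm (v - v'))" unfolding d_def .
  qed (use K in \<open>auto simp: add_pos_pos\<close>)
qed

section \<open>Picard iteration on a complex disc\<close>

lemma ball_derivative_bound:
  fixes p :: "complex \<Rightarrow> complex"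
  assumes "\<And>z. z \<in> ball c \<delta> \<Longrightarrow> (p has_field_derivative h z) (at z)"
    and "\<And>z. z \<in> ball c \<delta> \<Longrightarrow> norm (h z) \<le> B" and "z \<in> ball c \<delta>"
  shows "norm (p z - p c) \<le> B * \<delta>"
proof -
  have d: "\<delta> > 0" using assms(3) by (simp add: le_less_trans[OF zero_le_dist])
  have "norm (h c) \<le> B" using assms(2) d by simp
  then have "B \<ge> 0" using norm_ge_zero[of "h c"] by linarith
  have "norm (p z - p c) \<le> B * norm (z - c)"
    by (rule field_differentiable_bound[of "ball c \<delta>" p h])
      (use assms d in \<open>auto intro: DERIV_subset[OF _ subset_UNIV]\<close>)
  also have "\<dots> \<le> B * \<delta>"
    using assms(3) \<open>B \<ge> 0\<close> by (intro mult_left_mono) (auto simp: dist_norm norm_minus_commute)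
  finally show ?thesis .
qed

text \<open>Holomorphic functions have primitives on convex open sets. The primitive with prescribed
  value at the centre takes the place of the integral in Picard iteration.\<close>

lemma holomorphic_ball_primitive:
  assumes "h holomorphic_on ball c \<delta>"
  shows "\<exists>p. p c = a \<and> (\<forall>z\<in>ball c \<delta>. (p has_field_derivative h z) (at z))"
proof -
  obtain g where g: "\<And>z. z \<in> ball c \<delta> \<Longrightarrow> (g has_field_derivative h z) (at z)"
    using holomorphic_convex_primitive'[OF convex_ball open_ball assms] by (metis at_within_open open_ball)
  show ?thesis
    by (rule exI[of _ "\<lambda>z. g z - g c + a"]) (auto intro!: derivative_eq_intros g)
qed

text \<open>The differences telescope, and the Weierstrass M-test applies to their sum.\<close>

lemma geometric_uniform_limit:
  fixes U :: "nat \<Rightarrow> complex \<Rightarrow> complex"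
  assumes "\<And>n z. z \<in> S \<Longrightarrow> norm (U (Suc n) z - U n z) \<le> B * (1/2) ^ n"
  shows "\<exists>u. uniform_limit S U u sequentially"
proof -
  define G where "G z = (\<Sum>i. U (Suc i) z - U i z)" for z
  have "uniform_limit S (\<lambda>n z. \<Sum>i<n. U (Suc i) z - U i z) G sequentially"
    unfolding G_def by (rule Weierstrass_m_test[OF assms]) (auto intro!: summable_mult summable_geometric)
  then have "uniform_limit S (\<lambda>n z. (U n z - U 0 z) + U 0 z) (\<lambda>z. G z + U 0 z) sequentially"
    unfolding sum_lessThan_telescope[of "\<lambda>i. U i z" for z] by (rule uniform_limit_add) (rule uniform_limit_const)
  then show ?thesis by auto
qed

text \<open>All iterates live on the whole disc. The condition \<open>L * \<delta> \<le> 1/4\<close>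
  does two jobs: it keeps the iterates within distance 1 of the initial data, where
  \<open>bd\<close> and \<open>lip\<close> hold, and it makes the iteration a contraction.\<close>

lemma picard_existence:
  fixes f g :: "complex \<Rightarrow> complex \<Rightarrow> complex \<Rightarrow> complex"
  assumes "poly3 f" "poly3 g" "\<delta> > 0" "L * \<delta> \<le> 1/4" "L > 0"
    and bd: "\<And>z u v. \<lbrakk>z \<in> ball c \<delta>; norm (u - u0) \<le> 1; norm (v - v0) \<le> 1\<rbrakk> \<Longrightarrow> norm (f z u v) \<le> L \<and> norm (g z u v) \<le> L"
    and lip: "\<And>z u v u' v'. \<lbrakk>z \<in> ball c \<delta>; norm (u - u0) \<le> 1; norm (v - v0) \<le> 1;
               norm (u' - u0) \<le> 1; norm (v' - v0) \<le> 1\<rbrakk> \<Longrightarrow>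
              norm (f z u v - f z u' v') \<le> L * (norm (u - u') + norm (v - v')) \<and>
              norm (g z u v - g z u' v') \<le> L * (norm (u - u') + norm (v - v'))"
  shows "\<exists>u v. u c = u0 \<and> v c = v0 \<and> (\<forall>z\<in>ball c \<delta>.
           (u has_field_derivative f z (u z) (v z)) (at z) \<and>
           (v has_field_derivative g z (u z) (v z)) (at z))"
proof -
  \<comment> \<open>Choice turns the existence of a primitive into an operator that can be iterated.
    Its two properties are available only for holomorphic \<open>h\<close>, which is why holomorphy
    of the iterates comes first.\<close>
  define prim where "prim h a = (SOME p. p c = a \<and> (\<forall>z\<in>ball c \<delta>. (p has_field_derivative h z) (at z)))"
    for h :: "complex \<Rightarrow> complex" and a
  have prim: "prim h a c = a" "z \<in> ball c \<delta> \<Longrightarrow> (prim h a has_field_derivative h z) (at z)"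
    if "h holomorphic_on ball c \<delta>" for h a z
    using someI_ex[OF holomorphic_ball_primitive[OF that, of a]] unfolding prim_def by auto
  define T where "T = rec_nat (\<lambda>z. u0, \<lambda>z. v0)
     (\<lambda>_ p. (prim (\<lambda>z. f z (fst p z) (snd p z)) u0, prim (\<lambda>z. g z (fst p z) (snd p z)) v0))"
  define U where "U n = fst (T n)" for n
  define V where "V n = snd (T n)" for n
  have U0: "U 0 = (\<lambda>z. u0)" "V 0 = (\<lambda>z. v0)" by (auto simp: U_def V_def T_def)
  have US: "U (Suc n) = prim (\<lambda>z. f z (U n z) (V n z)) u0"
           "V (Suc n) = prim (\<lambda>z. g z (U n z) (V n z)) v0" for n by (auto simp: U_def V_def T_def)
  have hol: "U n holomorphic_on ball c \<delta> \<and> V n holomorphic_on ball c \<delta>" for n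
  proof (induction n)
    case (Suc n)
    then have "(\<lambda>z. f z (U n z) (V n z)) holomorphic_on ball c \<delta>"
      "(\<lambda>z. g z (U n z) (V n z)) holomorphic_on ball c \<delta>"
      using assms(1,2) by (auto intro: poly3_holomorphic)
    from prim(2)[OF this(1)] prim(2)[OF this(2)] show ?case
      unfolding US by (meson field_differentiable_at_within field_differentiable_def holomorphic_onI)
  qed (simp add: U0)
  have hf: "(\<lambda>z. f z (U n z) (V n z)) holomorphic_on ball c \<delta>"
    and hg: "(\<lambda>z. g z (U n z) (V n z)) holomorphic_on ball c \<delta>" for n
    using hol assms(1,2) by (auto intro: poly3_holomorphic)
  have Uc: "U n c = u0 \<and> V n c = v0" for n
    by (cases n) (simp_all add: U0 US prim(1)[OF hf] prim(1)[OF hg])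
  have bnd: "\<forall>z\<in>ball c \<delta>. norm (U n z - u0) \<le> 1 \<and> norm (V n z - v0) \<le> 1" for n
  proof (induction n)
    case (Suc n)
    show ?case
    proof
      fix z assume z: "z \<in> ball c \<delta>"
      have "norm (U (Suc n) z - U (Suc n) c) \<le> L * \<delta>"
        by (rule ball_derivative_bound[OF _ _ z, where h = "\<lambda>z. f z (U n z) (V n z)"])
          (use prim(2)[OF hf] bd Suc in \<open>auto simp: US\<close>)
      moreover have "norm (V (Suc n) z - V (Suc n) c) \<le> L * \<delta>"
        by (rule ball_derivative_bound[OF _ _ z, where h = "\<lambda>z. g z (U n z) (V n z)"])
          (use prim(2)[OF hg] bd Suc in \<open>auto simp: US\<close>)
      ultimately show "norm (U (Suc n) z - u0) \<le> 1 \<and> norm (V (Suc n) z - v0) \<le> 1"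
        using assms(4) by (simp add: Uc)
    qed
  qed (simp add: U0)
  \<comment> \<open>The hypothesis bounds the sum of both differences by \<open>B\<close>, the
    conclusion bounds each one by \<open>B / 4\<close>; hence the sum is halved in every
    step.\<close>
  have contract: "norm (prim (\<lambda>z. f z (u z) (v z)) u0 z - prim (\<lambda>z. f z (u' z) (v' z)) u0 z) \<le> B / 4 \<and>
      norm (prim (\<lambda>z. g z (u z) (v z)) v0 z - prim (\<lambda>z. g z (u' z) (v' z)) v0 z) \<le> B / 4"
    if h: "u holomorphic_on ball c \<delta>" "v holomorphic_on ball c \<delta>"
      "u' holomorphic_on ball c \<delta>" "v' holomorphic_on ball c \<delta>"
    and b: "\<And>z. z \<in> ball c \<delta> \<Longrightarrow> norm (u z - u0) \<le> 1 \<and> norm (v z - v0) \<le> 1"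
      "\<And>z. z \<in> ball c \<delta> \<Longrightarrow> norm (u' z - u0) \<le> 1 \<and> norm (v' z - v0) \<le> 1"
    and B: "\<And>z. z \<in> ball c \<delta> \<Longrightarrow> norm (u z - u' z) + norm (v z - v' z) \<le> B" 
    and z: "z \<in> ball c \<delta>" for u v u' v' B z
  proof -
    have "B \<ge> 0" using B[OF z] norm_ge_zero[of "u z - u' z"] norm_ge_zero[of "v z - v' z"] by linarith
    have 1: "(\<lambda>z. f z (u z) (v z)) holomorphic_on ball c \<delta>" "(\<lambda>z. f z (u' z) (v' z)) holomorphic_on ball c \<delta>"
      "(\<lambda>z. g z (u z) (v z)) holomorphic_on ball c \<delta>" "(\<lambda>z. g z (u' z) (v' z)) holomorphic_on ball c \<delta>"
      using h assms(1,2) by (auto intro: poly3_holomorphic)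
    have 2: "norm (f z (u z) (v z) - f z (u' z) (v' z)) \<le> L * B \<and>
             norm (g z (u z) (v z) - g z (u' z) (v' z)) \<le> L * B" if "z \<in> ball c \<delta>" for z
    proof -
      have "L * (norm (u z - u' z) + norm (v z - v' z)) \<le> L * B"
        using B[OF that] \<open>L > 0\<close> by (intro mult_left_mono) auto
      then show ?thesis
        using lip[OF that, of "u z" "v z" "u' z" "v' z"] b(1)[OF that] b(2)[OF that] by linarith
    qed
    let ?p = "\<lambda>z. prim (\<lambda>z. f z (u z) (v z)) u0 z - prim (\<lambda>z. f z (u' z) (v' z)) u0 z"
    let ?q = "\<lambda>z. prim (\<lambda>z. g z (u z) (v z)) v0 z - prim (\<lambda>z. g z (u' z) (v' z)) v0 z"
    have "norm (?p z - ?p c) \<le> (L * B) * \<delta>"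
      by (rule ball_derivative_bound[OF _ _ z, where h = "\<lambda>z. f z (u z) (v z) - f z (u' z) (v' z)"])
        (use 2 in \<open>auto intro!: derivative_intros prim(2)[OF 1(1)] prim(2)[OF 1(2)]\<close>)
    moreover have "norm (?q z - ?q c) \<le> (L * B) * \<delta>"
      by (rule ball_derivative_bound[OF _ _ z, where h = "\<lambda>z. g z (u z) (v z) - g z (u' z) (v' z)"])
        (use 2 in \<open>auto intro!: derivative_intros prim(2)[OF 1(3)] prim(2)[OF 1(4)]\<close>)
    moreover have "(L * B) * \<delta> \<le> B / 4"
      using mult_right_mono[OF assms(4) \<open>B \<ge> 0\<close>] by (simp add: mult_ac)
    ultimately show ?thesis
      using prim(1)[OF 1(1)] prim(1)[OF 1(2)] prim(1)[OF 1(3)] prim(1)[OF 1(4)] by simp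
  qed
  have geo: "\<forall>z\<in>ball c \<delta>. norm (U (Suc n) z - U n z) \<le> 1 * (1/2) ^ n \<and> norm (V (Suc n) z - V n z) \<le> 1 * (1/2)^n" for n
  proof (induction n)
    case 0
    then show ?case using bnd[of 1] by (simp add: U0)
  next
    case (Suc n)
    have s: "norm (U (Suc n) z - U n z) + norm (V (Suc n) z - V n z) \<le> 2 * (1/2)^n" if "z \<in> ball c \<delta>" for z
      using bspec[OF Suc that] by simp
    show ?case
    proof
      fix z assume z: "z \<in> ball c \<delta>"
      have "norm (U (Suc (Suc n)) z - U (Suc n) z) \<le> 2 * (1/2)^n / 4 \<and> norm (V (Suc (Suc n)) z - V (Suc n) z) \<le> 2 * (1/2)^n / 4"
        unfolding US(1)[of "Suc n"] US(2)[of "Suc n"] unfolding US(1)[of n] US(2)[of n]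
        by (rule contract[OF _ _ _ _ _ _ _ z]) (use hol bnd s in \<open>auto simp: US[symmetric]\<close>)
      then show "norm (U (Suc (Suc n)) z - U (Suc n) z) \<le> 1 * (1/2) ^ Suc n \<and> norm (V (Suc (Suc n)) z - V (Suc n) z) \<le> 1 * (1/2) ^ Suc n"
        by simp
    qed
  qed
  obtain u v where u: "uniform_limit (ball c \<delta>) U u sequentially" and v: "uniform_limit (ball c \<delta>) V v sequentially"
    using geometric_uniform_limit[of "ball c \<delta>" U 1] geometric_uniform_limit[of "ball c \<delta>" V 1] geo by metis
  have lim_hol: "w holomorphic_on ball c \<delta>"
    if "\<And>n. X n holomorphic_on ball c \<delta>" "uniform_limit (ball c \<delta>) X w sequentially" for X w
  proof (rule holomorphic_uniform_sequence[OF open_ball that(1)])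
    fix x assume "x \<in> ball c \<delta>"
    then obtain d where "d > 0" "cball x d \<subseteq> ball c \<delta>"
      using open_contains_cball open_ball by metis
    then show "\<exists>d. 0 < d \<and> cball x d \<subseteq> ball c \<delta> \<and> uniform_limit (cball x d) X w sequentially"
      using uniform_limit_on_subset[OF that(2)] by blast
  qed
  have uh: "u holomorphic_on ball c \<delta>" and vh: "v holomorphic_on ball c \<delta>"
    using lim_hol[OF _ u] lim_hol[OF _ v] hol by auto
  have ul: "(\<lambda>n. U n z) \<longlonglongrightarrow> u z" and vl: "(\<lambda>n. V n z) \<longlonglongrightarrow> v z" if "z \<in> ball c \<delta>" for z
    using u v that by (auto intro: tendsto_uniform_limitI)
  have ub: "norm (u z - u0) \<le> 1 \<and> norm (v z - v0) \<le> 1" if "z \<in> ball c \<delta>" for z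
    using bnd that by (auto intro!: LIMSEQ_le_const2[OF tendsto_norm[OF tendsto_diff[OF ul[OF that] tendsto_const]]]
         LIMSEQ_le_const2[OF tendsto_norm[OF tendsto_diff[OF vl[OF that] tendsto_const]]])
  let ?p = "prim (\<lambda>z. f z (u z) (v z)) u0" and ?q = "prim (\<lambda>z. g z (u z) (v z)) v0"
  \<comment> \<open>The limit is a fixed point: by \<open>contract\<close>, applied to the iterates
    and their limit, the next iterates converge to \<open>?p\<close> and \<open>?q\<close>, but they
    also converge to \<open>u\<close> and \<open>v\<close>.\<close>
  have eq: "u z = ?p z \<and> v z = ?q z" if z: "z \<in> ball c \<delta>" for z
  proof -
    have *: "\<forall>\<^sub>F n in sequentially. norm (U (Suc n) z - ?p z) \<le> e \<and> norm (V (Suc n) z - ?q z) \<le> e" if "e > 0" for e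
    proof -
      have "\<forall>\<^sub>F n in sequentially. \<forall>z\<in>ball c \<delta>. dist (U n z) (u z) < e"
        "\<forall>\<^sub>F n in sequentially. \<forall>z\<in>ball c \<delta>. dist (V n z) (v z) < e"
        using u v \<open>e > 0\<close> unfolding uniform_limit_iff by blast+
      then show ?thesis
      proof eventually_elim
        case (elim n)
        then have "norm (U n z - u z) + norm (V n z - v z) \<le> 2 * e" if "z \<in> ball c \<delta>" for z
          using bspec[OF elim(1) that] bspec[OF elim(2) that] by (simp add: dist_norm)
        then have "norm (U (Suc n) z - ?p z) \<le> 2 * e / 4 \<and> norm (V (Suc n) z - ?q z) \<le> 2 * e / 4"
          unfolding US by (intro contract[OF _ _ _ _ _ _ _ z]) (use hol bnd uh vh ub in auto)
        then show ?case using \<open>e > 0\<close> by simp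
      qed
    qed
    have "(\<lambda>n. U (Suc n) z) \<longlonglongrightarrow> ?p z" "(\<lambda>n. V (Suc n) z) \<longlonglongrightarrow> ?q z"
    proof -
      show "(\<lambda>n. U (Suc n) z) \<longlonglongrightarrow> ?p z"
      proof (rule tendstoI)
        fix e :: real assume "e > 0"
        then show "\<forall>\<^sub>F n in sequentially. dist (U (Suc n) z) (?p z) < e"
          using *[of "e/2"] by (auto elim!: eventually_mono simp: dist_norm)
      qed
      show "(\<lambda>n. V (Suc n) z) \<longlonglongrightarrow> ?q z"
      proof (rule tendstoI)
        fix e :: real assume "e > 0"
        then show "\<forall>\<^sub>F n in sequentially. dist (V (Suc n) z) (?q z) < e"
          using *[of "e/2"] by (auto elim!: eventually_mono simp: dist_norm)
      qed
    qed
    then show ?thesis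
      using LIMSEQ_unique[OF LIMSEQ_Suc[OF ul[OF z]]] LIMSEQ_unique[OF LIMSEQ_Suc[OF vl[OF z]]] by blast
  qed
  have "(\<lambda>z. f z (u z) (v z)) holomorphic_on ball c \<delta>" "(\<lambda>z. g z (u z) (v z)) holomorphic_on ball c \<delta>"
    using uh vh assms(1,2) by (auto intro: poly3_holomorphic)
  note h = this
  \<comment> \<open>The primitives serve as witnesses because their derivatives are known;
    \<open>eq\<close> then rewrites the right-hand sides.\<close>
  show ?thesis
  proof (rule exI[of _ ?p], rule exI[of _ ?q], intro conjI ballI)
    show "?p c = u0" "?q c = v0" using prim(1) h by auto
    fix z assume z: "z \<in> ball c \<delta>"
    show "(?p has_field_derivative f z (?p z) (?q z)) (at z)"
      "(?q has_field_derivative g z (?p z) (?q z)) (at z)"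
      using prim(2)[OF h(1) z, of u0] prim(2)[OF h(2) z, of v0] eq[OF z] by auto
  qed
qed

text \<open>The radius depends on \<open>M\<close> but not on the particular data: solutions stay
  within distance 1 of their data, so constants valid for norms up to \<open>M + 1\<close> serve all
  of them.\<close>

lemma polynomial_ode_uniform_existence:
  assumes "poly3 f" "poly3 g"
  shows "\<exists>\<delta>>0. \<forall>c u0 v0. norm c \<le> M \<and> norm u0 \<le> M \<and> norm v0 \<le> M \<longrightarrow>
          (\<exists>u v. u c = u0 \<and> v c = v0 \<and> (\<forall>z\<in>ball c \<delta>.
           (u has_field_derivative f z (u z) (v z)) (at z) \<and>
           (v has_field_derivative g z (u z) (v z)) (at z)))"
proof -
  obtain K L where K: "K > 0" "L > 0"
    and f: "\<And>z u v u' v'. norm z \<le> M + 1 \<and> norm u \<le> M + 1 \<and> norm v \<le> M + 1 \<and> norm u' \<le> M + 1 \<and> norm v' \<le> M + 1 \<Longrightarrow>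
           norm (f z u v) \<le> K \<and> norm (f z u v - f z u' v') \<le> K * (norm (u - u') + norm (v - v'))"
    and g: "\<And>z u v u' v'. norm z \<le> M + 1 \<and> norm u \<le> M + 1 \<and> norm v \<le> M + 1 \<and> norm u' \<le> M + 1 \<and> norm v' \<le> M + 1 \<Longrightarrow>
           norm (g z u v) \<le> L \<and> norm (g z u v - g z u' v') \<le> L * (norm (u - u') + norm (v - v'))"
    using poly3_lipschitz[OF assms(1), of "M + 1"] poly3_lipschitz[OF assms(2), of "M + 1"] by metis
  define B where "B = max K L"
  \<comment> \<open>The 1 keeps \<open>z\<close> within norm \<open>M + 1\<close>; the other term
    gives \<open>B * \<delta> \<le> 1/4\<close>, as Picard iteration demands.\<close>
  define \<delta> where "\<delta> = min 1 (1 / (4 * B))"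
  have B: "B > 0" "K \<le> B" "L \<le> B" and d: "\<delta> > 0" "\<delta> \<le> 1"
    using K by (auto simp: B_def \<delta>_def)
  have "B * \<delta> \<le> B * (1 / (4 * B))" using B by (intro mult_left_mono) (auto simp: \<delta>_def)
  then have Bd: "B * \<delta> \<le> 1/4" using B by simp
  have near: "norm w \<le> M + 1" if "norm (w - a) \<le> 1" "norm a \<le> M" for w a :: complex
    using norm_triangle_ineq2[of w a] that by linarith
  show ?thesis
  proof (intro exI[of _ \<delta>] conjI allI impI d(1))
    fix c u0 v0 :: complex assume a: "norm c \<le> M \<and> norm u0 \<le> M \<and> norm v0 \<le> M"
    have zb: "norm z \<le> M + 1" if "z \<in> ball c \<delta>" for z
      using near[of z c] that d a by (auto simp: dist_norm norm_minus_commute)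
    show "\<exists>u v. u c = u0 \<and> v c = v0 \<and> (\<forall>z\<in>ball c \<delta>.
           (u has_field_derivative f z (u z) (v z)) (at z) \<and>
           (v has_field_derivative g z (u z) (v z)) (at z))"
    proof (rule picard_existence[OF assms d(1) Bd B(1)])
      fix z u v u' v' assume z: "z \<in> ball c \<delta>" and uv: "norm (u - u0) \<le> 1" "norm (v - v0) \<le> 1"
      have b: "norm z \<le> M + 1" "norm u \<le> M + 1" "norm v \<le> M + 1" using zb[OF z] near uv a by auto
      show "norm (f z u v) \<le> B \<and> norm (g z u v) \<le> B"
        using f[of z u v u v] g[of z u v u v] b B by fastforce
      assume uv': "norm (u' - u0) \<le> 1" "norm (v' - v0) \<le> 1"
      have b': "norm u' \<le> M + 1" "norm v' \<le> M + 1" using near uv' a by auto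
      have "K * (norm (u - u') + norm (v - v')) \<le> B * (norm (u - u') + norm (v - v'))"
        "L * (norm (u - u') + norm (v - v')) \<le> B * (norm (u - u') + norm (v - v'))"
        using B by (auto intro!: mult_right_mono)
      then show "norm (f z u v - f z u' v') \<le> B * (norm (u - u') + norm (v - v')) \<and>
              norm (g z u v - g z u' v') \<le> B * (norm (u - u') + norm (v - v'))"
        using f[of z u v u' v'] g[of z u v u' v'] b b' by fastforce
    qed
  qed
qed

subsection \<open>Meromorphic solutions and their uniqueness\<close>

definition painleve1_at :: "(complex \<Rightarrow> complex) \<Rightarrow> (complex \<Rightarrow> complex) \<Rightarrow> complex \<Rightarrow> bool" where
  "painleve1_at X Y z \<longleftrightarrow> (X has_field_derivative 6 * (Y z)\<^sup>2 + z) (at z) \<and> (Y has_field_derivative X z) (at z)"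

text \<open>Poles carry the value 0, so that a solution is determined pointwise by its germ at one point.\<close>

definition painleve1_pole :: "(complex \<Rightarrow> complex) \<Rightarrow> (complex \<Rightarrow> complex) \<Rightarrow> complex \<Rightarrow> bool" where
  "painleve1_pole X Y z \<longleftrightarrow> is_pole X z \<and> is_pole Y z \<and> X z = 0 \<and> Y z = 0"

text \<open>The condition is local at each point, so it passes to subsets and unions directly. The
  punctured disc makes the exceptional points isolated, and the alternative at \<open>p\<close>
  leaves no essential singularities.\<close>

definition painleve1_mero_on :: "complex set \<Rightarrow> (complex \<Rightarrow> complex) \<Rightarrow> (complex \<Rightarrow> complex) \<Rightarrow> bool" where
  "painleve1_mero_on U X Y \<longleftrightarrow> (\<forall>p\<in>U. (\<exists>e>0. \<forall>z\<in>ball p e - {p}. painleve1_at X Y z) \<and>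
     (painleve1_at X Y p \<or> painleve1_pole X Y p))"

lemma painleve1_mero_onI_at:
  assumes "open U" "\<And>z. z \<in> U \<Longrightarrow> painleve1_at X Y z"
  shows "painleve1_mero_on U X Y"
  unfolding painleve1_mero_on_def
proof
  fix p assume p: "p \<in> U"
  then obtain e where "e > 0" "ball p e \<subseteq> U" using assms(1) open_contains_ball by blast
  then show "(\<exists>e>0. \<forall>z\<in>ball p e - {p}. painleve1_at X Y z) \<and> (painleve1_at X Y p \<or> painleve1_pole X Y p)"
    using assms(2) p by blast
qed

lemma painleve1_mero_on_subset:
  "painleve1_mero_on U X Y \<Longrightarrow> V \<subseteq> U \<Longrightarrow> painleve1_mero_on V X Y"
  unfolding painleve1_mero_on_def by blast

text \<open>The differences solve the linear system
  \<open>(X - X')' = 6 * (Y + Y') * (Y - Y')\<close>, \<open>(Y - Y')' = X - X'\<close> with zero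
  initial values. On a small disc the mean value bound improves any estimate by a factor 1/2, so
  repetition forces them to vanish.\<close>

lemma painleve1_local_unique:
  assumes e: "e > 0"
    and p: "\<And>z. z \<in> ball c e \<Longrightarrow> painleve1_at X Y z" "\<And>z. z \<in> ball c e \<Longrightarrow> painleve1_at X' Y' z"
    and c: "X c = X' c" "Y c = Y' c"
  shows "\<exists>d>0. \<forall>z\<in>ball c d. X z = X' z \<and> Y z = Y' z"
proof -
  have sub: "z \<in> ball c e" if "z \<in> cball c (e / 2)" for z using that e by auto
  have "continuous_on (ball c e) f" if "f \<in> {X, Y, X', Y'}" for f
    using that p DERIV_isCont unfolding painleve1_at_def
    by (intro continuous_at_imp_continuous_on) blast
  then have cont: "continuous_on (cball c (e / 2)) f" if "f \<in> {X, Y, X', Y'}" for f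
    using that sub continuous_on_subset by blast
  have "compact ((\<lambda>z. 6 * (Y z + Y' z)) ` cball c (e / 2))" "compact ((\<lambda>z. X z - X' z) ` cball c (e / 2))"
    "compact ((\<lambda>z. Y z - Y' z) ` cball c (e / 2))"
    by (intro compact_continuous_image compact_cball continuous_intros cont; simp)+
  then obtain N B1 B2 where N: "\<And>z. z \<in> cball c (e / 2) \<Longrightarrow> norm (6 * (Y z + Y' z)) \<le> N"
    and B1: "\<And>z. z \<in> cball c (e / 2) \<Longrightarrow> norm (X z - X' z) \<le> B1"
    and B2: "\<And>z. z \<in> cball c (e / 2) \<Longrightarrow> norm (Y z - Y' z) \<le> B2"
    using compact_imp_bounded bounded_iff by (metis (no_types, lifting) image_eqI)
  \<comment> \<open>\<open>N\<close> controls the coefficient in the equation for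
    \<open>X - X'\<close>, and 1 is the coefficient in the equation for
    \<open>Y - Y'\<close>.\<close>
  define A where "A = max N 1"
  define B where "B = B1 + B2"
  define d where "d = min (e / 2) (1 / (4 * A))"
  have A: "A > 0" "N \<le> A" "1 \<le> A" by (auto simp: A_def)
  have d: "d > 0" "d \<le> e / 2" using e A by (auto simp: d_def)
  have "A * d \<le> A * (1 / (4 * A))" using A by (intro mult_left_mono) (auto simp: d_def)
  then have Ad: "A * d \<le> 1 / 4" using A by simp
  have in_c: "z \<in> cball c (e / 2)" "z \<in> ball c e" if "z \<in> ball c d" for z using that d e by auto
  have "\<forall>z\<in>ball c d. norm (X z - X' z) \<le> B * (1/2) ^ n \<and> norm (Y z - Y' z) \<le> B * (1/2) ^ n" for n
  proof (induction n)
    case 0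
    show ?case
    proof
      fix z assume "z \<in> ball c d"
      from B1[OF in_c(1)[OF this]] B2[OF in_c(1)[OF this]]
      have "norm (X z - X' z) \<le> B" "norm (Y z - Y' z) \<le> B"
        using norm_ge_zero[of "X z - X' z"] norm_ge_zero[of "Y z - Y' z"] unfolding B_def by linarith+
      then show "norm (X z - X' z) \<le> B * (1/2) ^ 0 \<and> norm (Y z - Y' z) \<le> B * (1/2) ^ 0" by simp
    qed
  next
    case (Suc n)
    define b where "b = B * (1/2) ^ n"
    have b0: "b \<ge> 0" using Suc d unfolding b_def by (meson centre_in_ball norm_ge_zero order_trans)
    have Ab: "A * b * d \<le> b / 2" using mult_right_mono[OF Ad b0] b0 by (simp add: mult_ac)
    show ?case
    proof
      fix z assume z: "z \<in> ball c d"
      have "norm ((X z - X' z) - (X c - X' c)) \<le> (A * b) * d"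
      proof (rule ball_derivative_bound[OF _ _ z, where h = "\<lambda>w. 6 * (Y w + Y' w) * (Y w - Y' w)"])
        fix w assume w: "w \<in> ball c d"
        show "((\<lambda>z. X z - X' z) has_field_derivative 6 * (Y w + Y' w) * (Y w - Y' w)) (at w)"
          using p(1)[OF in_c(2)[OF w]] p(2)[OF in_c(2)[OF w]] unfolding painleve1_at_def
          by (auto intro!: derivative_eq_intros simp: algebra_simps power2_eq_square)
        show "norm (6 * (Y w + Y' w) * (Y w - Y' w)) \<le> A * b"
          unfolding norm_mult[of "6 * (Y w + Y' w)"]
          using N[OF in_c(1)[OF w]] bspec[OF Suc w] A by (intro mult_mono) (auto simp: b_def)
      qed
      moreover have "norm ((Y z - Y' z) - (Y c - Y' c)) \<le> (A * b) * d"
      proof (rule ball_derivative_bound[OF _ _ z, where h = "\<lambda>w. X w - X' w"])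
        fix w assume w: "w \<in> ball c d"
        show "((\<lambda>z. Y z - Y' z) has_field_derivative X w - X' w) (at w)"
          using p(1)[OF in_c(2)[OF w]] p(2)[OF in_c(2)[OF w]] unfolding painleve1_at_def
          by (auto intro!: derivative_eq_intros)
        have "b \<le> A * b" using A b0 by (simp add: mult_le_cancel_right1)
        then show "norm (X w - X' w) \<le> A * b" using bspec[OF Suc w] by (simp add: b_def)
      qed
      ultimately show "norm (X z - X' z) \<le> B * (1/2) ^ Suc n \<and> norm (Y z - Y' z) \<le> B * (1/2) ^ Suc n"
        using Ab c unfolding b_def by simp
    qed
  qed
  note bnd = this
  have lim: "(\<lambda>n. B * (1/2) ^ n) \<longlonglongrightarrow> B * 0"
    by (intro tendsto_mult tendsto_const LIMSEQ_power_zero) simp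
  have "X z = X' z \<and> Y z = Y' z" if z: "z \<in> ball c d" for z
  proof -
    have "norm (X z - X' z) \<le> B * 0" "norm (Y z - Y' z) \<le> B * 0"
      by (rule LIMSEQ_le_const[OF lim]; use bnd z in blast)+
    then show ?thesis by simp
  qed
  then show ?thesis using d by blast
qed

lemma painleve1_at_imp_not_pole:
  assumes "painleve1_at X Y p" shows "\<not> is_pole X p" "\<not> is_pole Y p"
  using assms DERIV_isCont not_tendsto_and_filterlim_at_infinity[OF trivial_limit_at]
  unfolding painleve1_at_def is_pole_def isCont_def by blast+

text \<open>Being a pole depends only on values nearby, so both pairs are regular or both have
  poles. In the first case continuity determines the values, in the second they are 0 by
  convention.\<close>

lemma painleve1_at_eq_of_eventually_eq:
  assumes p: "painleve1_at X Y p \<or> painleve1_pole X Y p" "painleve1_at X' Y' p \<or> painleve1_pole X' Y' p"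
    and ev: "\<forall>\<^sub>F z in at p. X z = X' z \<and> Y z = Y' z"
  shows "X p = X' p \<and> Y p = Y' p"
proof -
  have evX: "\<forall>\<^sub>F z in at p. X z = X' z" and evY: "\<forall>\<^sub>F z in at p. Y z = Y' z"
    using ev by (auto elim: eventually_mono)
  have "is_pole X p \<longleftrightarrow> is_pole X' p" using is_pole_cong[OF evX refl] .
  then consider "painleve1_at X Y p" "painleve1_at X' Y' p" | "painleve1_pole X Y p" "painleve1_pole X' Y' p"
    using p painleve1_at_imp_not_pole unfolding painleve1_pole_def by blast
  then show ?thesis
  proof cases
    case 1
    then have "X \<midarrow>p\<rightarrow> X p" "X' \<midarrow>p\<rightarrow> X' p" "Y \<midarrow>p\<rightarrow> Y p" "Y' \<midarrow>p\<rightarrow> Y' p"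
      unfolding painleve1_at_def using DERIV_isCont isCont_def by blast+
    then show ?thesis
      using tendsto_cong[OF evX] tendsto_cong[OF evY] LIM_unique by blast
  qed (simp add: painleve1_pole_def)
qed

lemma painleve1_at_imp_holomorphic_on:
  assumes "\<And>z. z \<in> S \<Longrightarrow> painleve1_at X Y z"
  shows "X holomorphic_on S" "Y holomorphic_on S"
  using assms unfolding painleve1_at_def
  by (meson field_differentiable_at_within field_differentiable_def holomorphic_onI)+

text \<open>Agreement near a point spreads by connectedness. Around any \<open>a\<close> both pairs
  are holomorphic on a punctured disc, which is connected; agreement on an open part fills it by
  analytic continuation and then reaches \<open>a\<close> itself.\<close>

lemma painleve1_mero_on_identity:
  assumes U: "open U" "connected U" and m: "painleve1_mero_on U X Y" "painleve1_mero_on U X' Y'"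
    and W: "open W" "c \<in> W" "c \<in> U" "\<And>z. z \<in> W \<Longrightarrow> X z = X' z \<and> Y z = Y' z"
    and z: "z \<in> U"
  shows "X z = X' z \<and> Y z = Y' z"
proof -
  define P where "P a \<longleftrightarrow> (\<forall>\<^sub>F z in nhds a. X z = X' z \<and> Y z = Y' z)" for a
  have common: "\<exists>e>0. ball a e \<subseteq> U \<and> (\<forall>z\<in>ball a e - {a}. painleve1_at X Y z \<and> painleve1_at X' Y' z)" if a: "a \<in> U" for a
  proof -
    obtain e1 where e1: "e1 > 0" "ball a e1 \<subseteq> U" using openE[OF U(1) a] by blast
    obtain e2 where e2: "e2 > 0" "\<forall>z\<in>ball a e2 - {a}. painleve1_at X Y z"
      using a m(1) unfolding painleve1_mero_on_def by blast
    obtain e3 where e3: "e3 > 0" "\<forall>z\<in>ball a e3 - {a}. painleve1_at X' Y' z"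
      using a m(2) unfolding painleve1_mero_on_def by blast
    define e where "e = min e1 (min e2 e3)"
    have "z \<in> ball a e2 - {a}" "z \<in> ball a e3 - {a}" if "z \<in> ball a e - {a}" for z
      using that by (auto simp: e_def)
    then have "\<forall>z\<in>ball a e - {a}. painleve1_at X Y z \<and> painleve1_at X' Y' z"
      using e2(2) e3(2) by (metis (no_types))
    moreover have "ball a e \<subseteq> U" "e > 0" using e1 e2(1) e3(1) by (auto simp: e_def)
    ultimately show ?thesis by (intro exI[of _ e]) (simp only: simp_thms)
  qed
  have Pc: "P c" unfolding P_def eventually_nhds using W by blast
  have "P z"
  proof (rule connected_induction_simple[where P = P, OF U(2) W(3) z Pc])
    fix a assume a: "a \<in> U"
    then obtain e where e: "e > 0" "ball a e \<subseteq> U"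
      and reg: "\<And>z. z \<in> ball a e - {a} \<Longrightarrow> painleve1_at X Y z \<and> painleve1_at X' Y' z"
      using common by blast
    have step: "P t" if s: "s \<in> ball a e" "P s" and t: "t \<in> ball a e" for s t
    proof -
      obtain S where S: "open S" "s \<in> S" "\<forall>z\<in>S. X z = X' z \<and> Y z = Y' z"
        using s(2) unfolding P_def eventually_nhds by blast
      \<comment> \<open>Removing \<open>a\<close> covers the case \<open>s = a\<close> as well;
        \<open>V\<close> stays nonempty because \<open>{a}\<close> is not open.\<close>
      define V where "V = S \<inter> (ball a e - {a})"
      have "open V" unfolding V_def using S by (intro open_Int open_Diff) auto
      have "V \<noteq> {}"
      proof
        assume "V = {}"
        then have "S \<inter> ball a e \<subseteq> {a}" unfolding V_def by blast
        moreover have "open (S \<inter> ball a e)" "S \<inter> ball a e \<noteq> {}" using S s by auto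
        ultimately show False using not_open_singleton[of a] by (metis subset_singletonD)
      qed
      have conn: "connected (ball a e - {a})" by (simp add: connected_punctured_ball)
      have opn: "open (ball a e - {a})" by (intro open_Diff) auto
      have hol: "X holomorphic_on ball a e - {a}" "Y holomorphic_on ball a e - {a}"
        "X' holomorphic_on ball a e - {a}" "Y' holomorphic_on ball a e - {a}"
        using painleve1_at_imp_holomorphic_on[of "ball a e - {a}"] reg by blast+
      have eq: "X w = X' w \<and> Y w = Y' w" if w: "w \<in> ball a e - {a}" for w
      proof
        have sub: "V \<subseteq> ball a e - {a}" by (simp add: V_def)
        show "X w = X' w"
          by (rule analytic_continuation_open[OF \<open>open V\<close> opn \<open>V \<noteq> {}\<close> conn sub _ _ _ w])
            (use S hol in \<open>auto simp: V_def\<close>)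
        show "Y w = Y' w"
          by (rule analytic_continuation_open[OF \<open>open V\<close> opn \<open>V \<noteq> {}\<close> conn sub _ _ _ w])
            (use S hol in \<open>auto simp: V_def\<close>)
      qed
      have "\<forall>\<^sub>F z in at a. z \<in> ball a e - {a}"
        using e(1) eventually_at_in_open[of "ball a e" a] by auto
      then have "\<forall>\<^sub>F z in at a. X z = X' z \<and> Y z = Y' z" by eventually_elim (use eq in blast)
      moreover have "painleve1_at X Y a \<or> painleve1_pole X Y a" "painleve1_at X' Y' a \<or> painleve1_pole X' Y' a"
        using m a unfolding painleve1_mero_on_def by blast+
      ultimately have "X a = X' a \<and> Y a = Y' a" by (intro painleve1_at_eq_of_eventually_eq)
      with eq have "X z = X' z \<and> Y z = Y' z" if "z \<in> ball a e" for z
        using that by (cases "z = a") simp_all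
      then show "P t" unfolding P_def eventually_nhds using t by (intro exI[of _ "ball a e"]) auto
    qed
    show "\<exists>T. openin (top_of_set U) T \<and> a \<in> T \<and> (\<forall>x\<in>T. \<forall>y\<in>T. P x \<longrightarrow> P y)"
    proof (intro exI[of _ "ball a e"] conjI ballI impI)
      show "openin (top_of_set U) (ball a e)" using e(2) U(1) by (simp add: openin_open_eq)
      show "a \<in> ball a e" using e(1) by simp
      fix s t assume "s \<in> ball a e" "t \<in> ball a e" "P s"
      then show "P t" using step[of s t] by blast
    qed
  qed
  then show ?thesis unfolding P_def by (rule eventually_nhds_x_imp_x)
qed

text \<open>Local uniqueness of the initial value problem supplies the open set from which the
  identity theorem starts.\<close>

lemma painleve1_mero_on_unique:
  assumes U: "open U" "connected U" and m: "painleve1_mero_on U X Y" "painleve1_mero_on U X' Y'"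
    and c: "c \<in> U" "painleve1_at X Y c" "painleve1_at X' Y' c" "X c = X' c" "Y c = Y' c"
    and z: "z \<in> U"
  shows "X z = X' z \<and> Y z = Y' z"
proof -
  obtain e1 where e1: "e1 > 0" "\<forall>z\<in>ball c e1 - {c}. painleve1_at X Y z"
    using c(1) m(1) unfolding painleve1_mero_on_def by blast
  obtain e2 where e2: "e2 > 0" "\<forall>z\<in>ball c e2 - {c}. painleve1_at X' Y' z"
    using c(1) m(2) unfolding painleve1_mero_on_def by blast
  have "painleve1_at X Y w \<and> painleve1_at X' Y' w" if "w \<in> ball c (min e1 e2)" for w
    using that e1(2) e2(2) c(2,3) by (cases "w = c") auto
  then obtain d where d: "d > 0" "\<And>w. w \<in> ball c d \<Longrightarrow> X w = X' w \<and> Y w = Y' w"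
    using painleve1_local_unique[of "min e1 e2" c X Y X' Y'] e1(1) e2(1) c(4,5) by auto
  show ?thesis
    by (rule painleve1_mero_on_identity[OF U m open_ball[of c d] _ c(1) d(2) z]) (use d(1) in auto)
qed

section \<open>Gluing of compatible solutions\<close>

lemma painleve1_at_cong:
  assumes "open S" "p \<in> S" "\<And>z. z \<in> S \<Longrightarrow> X z = X' z \<and> Y z = Y' z"
  shows "painleve1_at X Y p \<longleftrightarrow> painleve1_at X' Y' p"
proof -
  have ev: "\<forall>\<^sub>F z in nhds p. X z = X' z" "\<forall>\<^sub>F z in nhds p. Y z = Y' z"
    using assms eventually_nhds by blast+
  show ?thesis unfolding painleve1_at_def
    using DERIV_cong_ev[OF refl ev(1) refl] DERIV_cong_ev[OF refl ev(2) refl] assms(2,3) by simp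
qed

lemma painleve1_mero_on_cong:
  assumes S: "open S" and eq: "\<And>z. z \<in> S \<Longrightarrow> X z = X' z \<and> Y z = Y' z" and m: "painleve1_mero_on S X Y"
  shows "painleve1_mero_on S X' Y'"
  unfolding painleve1_mero_on_def
proof
  fix p assume p: "p \<in> S"
  have cong: "painleve1_at X Y z \<longleftrightarrow> painleve1_at X' Y' z" if "z \<in> S" for z
    using painleve1_at_cong[OF S that eq] .
  obtain e where e: "e > 0" "\<forall>z\<in>ball p e - {p}. painleve1_at X Y z"
    using m p unfolding painleve1_mero_on_def by blast
  obtain d where d: "d > 0" "ball p d \<subseteq> S" using openE[OF S p] by blast
  have "\<forall>z\<in>ball p (min e d) - {p}. painleve1_at X' Y' z"
  proof
    fix z assume "z \<in> ball p (min e d) - {p}"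
    then have "z \<in> ball p e - {p}" "z \<in> S" using d by auto
    then show "painleve1_at X' Y' z" using e cong by blast
  qed
  then have 1: "\<exists>e>0. \<forall>z\<in>ball p e - {p}. painleve1_at X' Y' z"
    using e d by (metis min_less_iff_conj)
  have "\<forall>\<^sub>F z in at p. X z = X' z" "\<forall>\<^sub>F z in at p. Y z = Y' z"
    using eventually_at_in_open'[OF S p] by (auto elim!: eventually_mono dest: eq)
  then have "painleve1_pole X Y p \<longleftrightarrow> painleve1_pole X' Y' p"
    unfolding painleve1_pole_def using is_pole_cong[OF _ refl] eq[OF p] by metis
  then show "(\<exists>e>0. \<forall>z\<in>ball p e - {p}. painleve1_at X' Y' z) \<and> (painleve1_at X' Y' p \<or> painleve1_pole X' Y' p)"
    using 1 m p cong unfolding painleve1_mero_on_def by blast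
qed

text \<open>At each point any index whose set contains it is chosen. Agreement on overlaps makes the
  choice irrelevant, so on each \<open>U i\<close> the glued pair is the given one.\<close>

lemma painleve1_mero_on_Union:
  assumes opn: "\<And>i. i \<in> I \<Longrightarrow> open (U i)"
    and m: "\<And>i. i \<in> I \<Longrightarrow> painleve1_mero_on (U i) (X i) (Y i)"
    and agree: "\<And>i j z. i \<in> I \<Longrightarrow> j \<in> I \<Longrightarrow> z \<in> U i \<Longrightarrow> z \<in> U j \<Longrightarrow> X i z = X j z \<and> Y i z = Y j z"
  shows "\<exists>X' Y'. painleve1_mero_on (\<Union>i\<in>I. U i) X' Y' \<and> (\<forall>i\<in>I. \<forall>z\<in>U i. X' z = X i z \<and> Y' z = Y i z)"
proof -
  define k where "k z = (SOME i. i \<in> I \<and> z \<in> U i)" for z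
  have k: "k z \<in> I \<and> z \<in> U (k z)" if "i \<in> I" "z \<in> U i" for i z
    unfolding k_def by (rule someI[of _ i]) (use that in auto)
  define X' where "X' z = X (k z) z" for z
  define Y' where "Y' z = Y (k z) z" for z
  have eq: "X' z = X i z \<and> Y' z = Y i z" if "i \<in> I" "z \<in> U i" for i z
    unfolding X'_def Y'_def using agree k that by blast
  have "painleve1_mero_on (U i) X' Y'" if "i \<in> I" for i
    by (rule painleve1_mero_on_cong[OF opn[OF that] _ m[OF that]]) (use eq that in auto)
  then have "painleve1_mero_on (\<Union>i\<in>I. U i) X' Y'" unfolding painleve1_mero_on_def by blast
  with eq show ?thesis by blast
qed

subsection \<open>Growth of the energy along segments\<close>

definition energy :: "complex \<Rightarrow> complex \<Rightarrow> complex \<Rightarrow> complex" where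
  "energy z x y = x\<^sup>2 - 4 * y ^ 3 - 2 * z * y + x * cnj y / (1 + y * cnj y)"

lemma one_plus_mult_cnj: "1 + y * cnj y = complex_of_real (1 + (norm y)\<^sup>2)"
  using complex_norm_square[of y] by simp

lemma one_plus_mult_cnj_nonzero: "1 + y * cnj y \<noteq> 0"
  unfolding one_plus_mult_cnj of_real_eq_0_iff by (smt (verit) zero_le_power2)

lemma norm_one_plus_mult_cnj: "norm (1 + y * cnj y) = 1 + (norm y)\<^sup>2"
  unfolding one_plus_mult_cnj norm_of_real by (smt (verit) zero_le_power2)

text \<open>The two norms are those of the coefficients of \<open>d\<close> and \<open>cnj d\<close>
  in the derivative of the energy along a segment with direction \<open>d\<close>. Eliminating
  \<open>x\<^sup>2\<close> through the energy cancels the terms that grow with \<open>y\<close>;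
  what is left is controlled by \<open>E\<close> and \<open>t = norm x / p\<close>.\<close>

lemma energy_derivative_bound:
  assumes "norm z \<le> R"
  shows "norm (- 2 * y + (6 * y\<^sup>2 + z) * cnj y / (1 + y * cnj y) - x\<^sup>2 * (cnj y)\<^sup>2 / (1 + y * cnj y)\<^sup>2) +
         norm (x * cnj x / (1 + y * cnj y)\<^sup>2) \<le> 21 * (1 + R) * (1 + norm (energy z x y))"
proof -
  define P where "P = 1 + y * cnj y"
  define p where "p = 1 + (norm y)\<^sup>2"
  define a where "a = norm y"
  define t where "t = norm x / p"
  define E where "E = energy z x y"
  have P: "P \<noteq> 0" unfolding P_def by (rule one_plus_mult_cnj_nonzero)
  have nP: "norm P = p" unfolding P_def p_def by (rule norm_one_plus_mult_cnj)
  have p: "p \<ge> 1" "p > 0" by (simp_all add: p_def add_pos_nonneg)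
  have R: "R \<ge> 0" using assms norm_ge_zero[of z] by linarith
  have a0: "a \<ge> 0" by (simp add: a_def)
  have ap: "a / p \<le> 1"
    using p sum_squares_bound[of a 1] a0 by (simp add: p_def a_def divide_le_eq)
  have aap: "a\<^sup>2 / p \<le> 1" using p by (simp add: p_def a_def divide_le_eq)
  have ap3: "a ^ 3 / p\<^sup>2 \<le> 1"
    using mult_mono[OF ap aap] a0 p by (simp add: power3_eq_cube power2_eq_square mult_ac)
  have t0: "t \<ge> 0" using p by (simp add: t_def)
  have x2: "x\<^sup>2 = E + 4 * y ^ 3 + 2 * z * y - x * cnj y / P"
    unfolding E_def energy_def P_def by simp
  \<comment> \<open>The decisive cancellation: each summand on the left grows like \<open>y\<close>,
    yet the total is bounded.\<close>
  have "- 2 * y + 6 * y\<^sup>2 * cnj y / P - 4 * y ^ 3 * (cnj y)\<^sup>2 / P\<^sup>2 = 2 * y * (y * cnj y - 1) / P\<^sup>2"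
    using P unfolding power2_eq_square by (simp add: field_simps) (simp add: P_def algebra_simps power3_eq_cube)
  moreover have "x\<^sup>2 * (cnj y)\<^sup>2 / P\<^sup>2 = 4 * y ^ 3 * (cnj y)\<^sup>2 / P\<^sup>2 + (E * (cnj y)\<^sup>2 / P\<^sup>2 + 2 * z * y * (cnj y)\<^sup>2 / P\<^sup>2 - x * (cnj y) ^ 3 / P ^ 3)"
    unfolding x2 using P by (simp add: field_simps power2_eq_square power3_eq_cube)
  ultimately have A1: "- 2 * y + (6 * y\<^sup>2 + z) * cnj y / P - x\<^sup>2 * (cnj y)\<^sup>2 / P\<^sup>2 =
      2 * y * (y * cnj y - 1) / P\<^sup>2 + z * cnj y / P - E * (cnj y)\<^sup>2 / P\<^sup>2 - 2 * z * y * (cnj y)\<^sup>2 / P\<^sup>2 + x * (cnj y) ^ 3 / P ^ 3"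
    by (simp add: distrib_right add_divide_distrib diff_diff_eq algebra_simps)
  have n1: "norm (2 * y * (y * cnj y - 1) / P\<^sup>2) \<le> 2"
  proof -
    have "norm (y * cnj y - 1) \<le> p"
      using norm_triangle_ineq4[of "y * cnj y" 1] by (simp add: p_def norm_mult power2_eq_square)
    then have "norm (y * cnj y - 1) / p \<le> 1" using p by simp
    with ap have "(a / p) * (norm (y * cnj y - 1) / p) \<le> 1 * 1"
      using a0 p by (intro mult_mono) auto
    then show ?thesis by (simp add: norm_mult norm_divide norm_power nP a_def power2_eq_square)
  qed
  have n2: "norm (z * cnj y / P) \<le> R"
    using mult_mono[OF assms ap] a0 p R by (simp add: norm_mult norm_divide nP a_def)
  have a2: "(a / p) * (a / p) \<le> 1 * 1" using ap a0 p by (intro mult_mono) auto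
  have n3: "norm (E * (cnj y)\<^sup>2 / P\<^sup>2) \<le> norm E"
    using mult_left_mono[OF a2, of "norm E"] by (simp add: norm_mult norm_divide norm_power nP a_def power2_eq_square)
  have n4: "norm (2 * z * y * (cnj y)\<^sup>2 / P\<^sup>2) \<le> 2 * R"
  proof -
    have "norm (2 * z * y * (cnj y)\<^sup>2 / P\<^sup>2) = 2 * (norm z * (a ^ 3 / p\<^sup>2))"
      by (simp add: norm_mult norm_divide norm_power nP a_def power3_eq_cube power2_eq_square)
    moreover have "norm z * (a ^ 3 / p\<^sup>2) \<le> R * 1" using assms ap3 a0 p R by (intro mult_mono) auto
    ultimately show ?thesis by simp
  qed
  have n5: "norm (x * (cnj y) ^ 3 / P ^ 3) \<le> t"
    using mult_left_mono[OF ap3 t0] by (simp add: norm_mult norm_divide norm_power nP a_def t_def power3_eq_cube power2_eq_square mult_ac)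
  have nA2: "norm (x * cnj x / P\<^sup>2) = t\<^sup>2"
    by (simp add: norm_mult norm_divide norm_power nP t_def power2_eq_square)
  \<comment> \<open>Dividing the energy relation by \<open>P\<^sup>2\<close> tames every power of
    \<open>y\<close>. The remaining linear \<open>t\<close> is absorbed below by
    \<open>2 * t \<le> 1 + t\<^sup>2\<close>.\<close>
  have "t\<^sup>2 \<le> norm E + 4 + 2 * R + t"
  proof -
    have "x\<^sup>2 / P\<^sup>2 = E / P\<^sup>2 + 4 * y ^ 3 / P\<^sup>2 + 2 * z * y / P\<^sup>2 - x * cnj y / P / P\<^sup>2"
      unfolding x2 by (simp only: add_divide_distrib diff_divide_distrib)
    moreover have "t\<^sup>2 = norm (x\<^sup>2 / P\<^sup>2)" by (simp add: t_def power_divide norm_divide norm_power nP)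
    ultimately have "t\<^sup>2 = norm (E / P\<^sup>2 + 4 * y ^ 3 / P\<^sup>2 + 2 * z * y / P\<^sup>2 - x * cnj y / P / P\<^sup>2)" by simp
    also have "\<dots> \<le> norm (E / P\<^sup>2) + norm (4 * y ^ 3 / P\<^sup>2) + norm (2 * z * y / P\<^sup>2) + norm (x * cnj y / P / P\<^sup>2)"
      by (intro order_trans[OF norm_triangle_ineq4] order_trans[OF norm_triangle_ineq] add_mono order_refl)
    finally have le: "t\<^sup>2 \<le> norm (E / P\<^sup>2) + norm (4 * y ^ 3 / P\<^sup>2) + norm (2 * z * y / P\<^sup>2) + norm (x * cnj y / P / P\<^sup>2)" .
    have pp: "p\<^sup>2 \<ge> 1" using p by simp
    have "norm (E / P\<^sup>2) \<le> norm E"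
      using pp p by (simp add: norm_divide norm_power nP divide_le_eq mult_le_cancel_left1)
    moreover have "norm (4 * y ^ 3 / P\<^sup>2) \<le> 4" using ap3 by (simp add: norm_divide norm_mult norm_power nP a_def)
    moreover have "norm (2 * z * y / P\<^sup>2) \<le> 2 * R"
    proof -
      have "(a / p) * (1 / p) \<le> 1 * 1" using ap p a0 by (intro mult_mono) auto
      then have "a / p / p \<le> 1" by simp
      then have "norm z * (a / p / p) \<le> R * 1" using assms R a0 p by (intro mult_mono) auto
      then show ?thesis by (simp add: norm_divide norm_mult norm_power nP a_def power2_eq_square)
    qed
    moreover have "norm (x * cnj y / P / P\<^sup>2) \<le> t"
    proof -
      have "(a / p) * (1 / p) \<le> 1 * 1" using ap p a0 by (intro mult_mono) auto
      then have "a / p / p \<le> 1" by simp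
      then have "t * (a / p / p) \<le> t * 1" using t0 by (rule mult_left_mono)
      then show ?thesis by (simp add: norm_divide norm_mult norm_power nP a_def t_def power2_eq_square mult_ac)
    qed
    ultimately show ?thesis using le by linarith
  qed
  moreover have tt: "2 * t \<le> 1 + t\<^sup>2" using sum_squares_bound[of t 1] by simp
  ultimately have t2: "t\<^sup>2 \<le> 2 * norm E + 9 + 4 * R" by linarith
  have "norm (2 * y * (y * cnj y - 1) / P\<^sup>2 + z * cnj y / P - E * (cnj y)\<^sup>2 / P\<^sup>2 - 2 * z * y * (cnj y)\<^sup>2 / P\<^sup>2 + x * (cnj y) ^ 3 / P ^ 3)
     \<le> 2 + R + norm E + 2 * R + t"
    by (intro order_trans[OF norm_triangle_ineq4] order_trans[OF norm_triangle_ineq] add_mono n1 n2 n3 n4 n5)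
  then have "norm (- 2 * y + (6 * y\<^sup>2 + z) * cnj y / P - x\<^sup>2 * (cnj y)\<^sup>2 / P\<^sup>2) + norm (x * cnj x / P\<^sup>2)
      \<le> 2 + R + norm E + 2 * R + t + t\<^sup>2"
    unfolding nA2 A1 by simp
  \<comment> \<open>With the bounds on \<open>t\<close> and \<open>t\<^sup>2\<close> the left side
    is at most \<open>16 + 9 * R + 4 * norm E\<close>, so 21 leaves room.\<close>
  also have "\<dots> \<le> 21 * (1 + R) * (1 + norm E)"
  proof -
    have "21 * (1 + R) * (1 + norm E) = 21 + 21 * R + 21 * norm E + 21 * (R * norm E)"
      by (simp add: algebra_simps)
    moreover have "R * norm E \<ge> 0" using R by simp
    ultimately show ?thesis using t2 tt R norm_ge_zero[of E] by linarith
  qed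
  finally show ?thesis unfolding P_def E_def .
qed

text \<open>The energy contains \<open>cnj y\<close> and is not holomorphic along solutions, so it
  is differentiated in the real parameter only. Differentiating \<open>cnj y\<close> produces the
  \<open>cnj d\<close> term; in the Hamiltonian part everything but \<open>- 2 * y\<close>
  cancels.\<close>

lemma energy_path_derivative:
  fixes x y :: "real \<Rightarrow> complex"
  assumes x: "(x has_vector_derivative d * (6 * (y s)\<^sup>2 + (z0 + of_real s * d))) (at s)"
    and y: "(y has_vector_derivative d * x s) (at s)"
  defines "z \<equiv> z0 + of_real s * d"
  shows "((\<lambda>s. energy (z0 + of_real s * d) (x s) (y s)) has_vector_derivative
     d * (- 2 * y s + (6 * (y s)\<^sup>2 + z) * cnj (y s) / (1 + y s * cnj (y s)) - (x s)\<^sup>2 * (cnj (y s))\<^sup>2 / (1 + y s * cnj (y s))\<^sup>2)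
     + cnj d * (x s * cnj (x s) / (1 + y s * cnj (y s))\<^sup>2)) (at s)"
proof -
  have P: "1 + y s * cnj (y s) \<noteq> 0" by (rule one_plus_mult_cnj_nonzero)
  note x' = x[unfolded has_vector_derivative_def] and y' = y[unfolded has_vector_derivative_def]
  show ?thesis
    unfolding energy_def has_vector_derivative_def
    apply (rule derivative_eq_intros x' y' has_derivative_cnj P refl)+
    apply (rule ext)
    apply (fold z_def)
    using P
    apply (simp add: scaleR_conv_of_real divide_simps)
    apply (simp add: algebra_simps power2_eq_square power3_eq_cube)
    done
qed
text \<open>Working with \<open>1 + (norm h)\<^sup>2\<close> avoids the points where the norm is not
  differentiable. Its derivative is at most \<open>3 * A\<close> times itself, since
  \<open>2 * n + 2 * n\<^sup>2 \<le> 3 * (1 + n\<^sup>2)\<close>; multiplied by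
  \<open>exp (- 3 * A * s)\<close> it therefore decreases.\<close>

lemma norm_gronwall:
  fixes h :: "real \<Rightarrow> complex"
  assumes h: "\<And>s. 0 \<le> s \<Longrightarrow> s \<le> 1 \<Longrightarrow> (h has_vector_derivative h' s) (at s)"
    and b: "\<And>s. 0 \<le> s \<Longrightarrow> s \<le> 1 \<Longrightarrow> norm (h' s) \<le> A * (1 + norm (h s))"
  shows "1 + (norm (h 1))\<^sup>2 \<le> (1 + (norm (h 0))\<^sup>2) * exp (3 * A)"
proof -
  have "(1 + (norm (h 1))\<^sup>2) * exp (- 3 * A * 1) \<le> (1 + (norm (h 0))\<^sup>2) * exp (- 3 * A * 0)"
  proof (rule DERIV_nonpos_imp_nonincreasing[where f = "\<lambda>s. (1 + (norm (h s))\<^sup>2) * exp (- 3 * A * s)"])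
    fix s :: real assume s: "0 \<le> s" "s \<le> 1"
    let ?e = "exp (- 3 * A * s)"
    have "((\<lambda>s. 1 + h s \<bullet> h s) has_real_derivative 2 * (h s \<bullet> h' s)) (at s)"
      unfolding has_field_derivative_def
      by (rule derivative_eq_intros h[OF s, unfolded has_vector_derivative_def] refl)+
        (auto simp: inner_commute algebra_simps)
    moreover have "((\<lambda>s. exp (- 3 * A * s)) has_real_derivative ?e * (- 3 * A)) (at s)"
      by (auto intro!: derivative_eq_intros)
    ultimately have "((\<lambda>s. (1 + h s \<bullet> h s) * exp (- 3 * A * s)) has_real_derivative
        2 * (h s \<bullet> h' s) * ?e + (1 + h s \<bullet> h s) * (?e * (- 3 * A))) (at s)"
      by (subst add.commute) (rule DERIV_mult')
    moreover have "2 * (h s \<bullet> h' s) * ?e + (1 + h s \<bullet> h s) * (?e * (- 3 * A)) \<le> 0"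
    proof -
      define n where "n = norm (h s)"
      have n: "n \<ge> 0" by (simp add: n_def)
      have "0 \<le> A * (1 + n)" using b[OF s] norm_ge_zero[of "h' s"] unfolding n_def by linarith
      then have A: "A \<ge> 0" using n by (simp add: zero_le_mult_iff)
      have "h s \<bullet> h' s \<le> n * norm (h' s)" using norm_cauchy_schwarz n_def by blast
      also have "\<dots> \<le> n * (A * (1 + n))" using b[OF s] n by (intro mult_left_mono) (auto simp: n_def)
      finally have "2 * (h s \<bullet> h' s) \<le> A * (2 * n + 2 * n\<^sup>2)" by (simp add: algebra_simps power2_eq_square)
      also have "\<dots> \<le> A * (3 * (1 + n\<^sup>2))"
        using A sum_squares_bound[of n 1] by (intro mult_left_mono) auto
      finally have "2 * (h s \<bullet> h' s) \<le> 3 * A * (1 + n\<^sup>2)" by (simp add: algebra_simps)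
      then have "(2 * (h s \<bullet> h' s) - 3 * A * (1 + n\<^sup>2)) * ?e \<le> 0"
        by (simp add: mult_le_0_iff)
      then show ?thesis by (simp add: n_def power2_norm_eq_inner algebra_simps)
    qed
    ultimately show "\<exists>y. ((\<lambda>s. (1 + (norm (h s))\<^sup>2) * exp (- 3 * A * s)) has_real_derivative y) (at s) \<and> y \<le> 0"
      unfolding power2_norm_eq_inner by blast
  qed simp
  then show ?thesis by (simp add: exp_minus field_simps)
qed

text \<open>The bound involves only the initial energy, the size of the region and the length of the
  segment. It stays uniform however large \<open>X\<close> and \<open>Y\<close> become when the
  segment runs close to a pole.\<close>

lemma energy_growth:
  assumes p1: "\<And>z. z \<in> closed_segment z0 z1 \<Longrightarrow> painleve1_at X Y z"
    and R: "\<And>z. z \<in> closed_segment z0 z1 \<Longrightarrow> norm z \<le> R"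
  shows "1 + (norm (energy z1 (X z1) (Y z1)))\<^sup>2 \<le>
    (1 + (norm (energy z0 (X z0) (Y z0)))\<^sup>2) * exp (63 * (1 + R) * norm (z1 - z0))"
proof -
  define d where "d = z1 - z0"
  define \<gamma> where "\<gamma> s = z0 + of_real s * d" for s
  define h where "h s = energy (\<gamma> s) (X (\<gamma> s)) (Y (\<gamma> s))" for s
  define h1 where "h1 s = (let z = \<gamma> s; y = Y z; x = X z in - 2 * y + (6 * y\<^sup>2 + z) * cnj y / (1 + y * cnj y) - x\<^sup>2 * (cnj y)\<^sup>2 / (1 + y * cnj y)\<^sup>2)" for s
  define h2 where "h2 s = (let y = Y (\<gamma> s); x = X (\<gamma> s) in x * cnj x / (1 + y * cnj y)\<^sup>2)" for s
  have seg: "\<gamma> s \<in> closed_segment z0 z1" if "0 \<le> s" "s \<le> 1" for s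
    using that unfolding closed_segment_def \<gamma>_def d_def
    by (auto intro!: exI[of _ s] simp: scaleR_conv_of_real algebra_simps)
  have \<gamma>': "(\<gamma> has_vector_derivative d) (at s)" for s
    unfolding \<gamma>_def has_vector_derivative_def
    by (auto intro!: derivative_eq_intros simp: scaleR_conv_of_real)
  \<comment> \<open>The exponent 63 is the Gronwall factor 3 times the 21 of the derivative
    estimate; \<open>norm d\<close> enters because the segment is parametrized over the unit
    interval.\<close>
  have "1 + (norm (h 1))\<^sup>2 \<le> (1 + (norm (h 0))\<^sup>2) * exp (3 * (norm d * (21 * (1 + R))))"
  proof (rule norm_gronwall[where h' = "\<lambda>s. d * h1 s + cnj d * h2 s"])
    fix s :: real assume s: "0 \<le> s" "s \<le> 1"
    note p = p1[OF seg[OF s], unfolded painleve1_at_def]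
    have "((X \<circ> \<gamma>) has_vector_derivative d * (6 * (Y (\<gamma> s))\<^sup>2 + \<gamma> s)) (at s)"
      using field_vector_diff_chain_at[OF \<gamma>' conjunct1[OF p]] .
    moreover have "((Y \<circ> \<gamma>) has_vector_derivative d * X (\<gamma> s)) (at s)"
      using field_vector_diff_chain_at[OF \<gamma>' conjunct2[OF p]] .
    ultimately show "(h has_vector_derivative d * h1 s + cnj d * h2 s) (at s)"
      using energy_path_derivative[of "X \<circ> \<gamma>" d "Y \<circ> \<gamma>" s z0]
      unfolding h_def h1_def h2_def \<gamma>_def by (simp add: o_def Let_def)
    have "norm (d * h1 s + cnj d * h2 s) \<le> norm d * (norm (h1 s) + norm (h2 s))"
      by (rule order_trans[OF norm_triangle_ineq]) (simp add: norm_mult distrib_left)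
    also have "\<dots> \<le> norm d * (21 * (1 + R) * (1 + norm (h s)))"
      using energy_derivative_bound[OF R[OF seg[OF s]]] unfolding h_def h1_def h2_def Let_def
      by (intro mult_left_mono) auto
    finally show "norm (d * h1 s + cnj d * h2 s) \<le> norm d * (21 * (1 + R)) * (1 + norm (h s))" by (simp add: mult.assoc)
  qed
  moreover have "3 * (norm d * (21 * (1 + R))) = 63 * (1 + R) * norm (z1 - z0)" by (simp add: d_def)
  moreover have "\<gamma> 0 = z0" "\<gamma> 1 = z1" by (simp_all add: \<gamma>_def d_def)
  ultimately show ?thesis by (simp only: h_def)
qed

subsection \<open>The chart at a pole\<close>

text \<open>
  The right-hand sides \<open>u' = pole_chart_u\<close> and \<open>v' = pole_chart_v\<close> are obtained by inserting
  \<open>y = 1 / u\<^sup>2\<close> and \<open>x = pole_chart_x\<close> into the Painleve equation. At \<open>u = 0\<close> division by zero gives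
  both \<open>x\<close> and \<open>y\<close> the value 0, as required by \<open>painleve1_pole\<close>.
\<close>

definition pole_chart_e where "pole_chart_e z u v = z / 4 + u / 4 - v * u\<^sup>2 / (2::complex)"

definition pole_chart_u where "pole_chart_u z u v = 1 + u ^ 4 * pole_chart_e z u v"

definition pole_chart_v where
  "pole_chart_v z u v = u * (z / 2 + u - 3 * v * u\<^sup>2) * pole_chart_e z u v"

text \<open>A truncated Laurent expansion of \<open>x\<close> in powers of \<open>u\<close>, with
  \<open>v\<close> at the power where solutions with a given pole have their free
  coefficient.\<close>

definition pole_chart_x where
  "pole_chart_x z u v = - 2 / u ^ 3 - z * u / 2 - u\<^sup>2 / 2 + v * u ^ 3" for z u v :: complex

lemma poly3_pole_chart: "poly3 pole_chart_u" "poly3 pole_chart_v"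
proof -
  \<comment> \<open>\<open>poly3\<close> has no rules for subtraction or division, hence the
    constant factors such as \<open>-1/2\<close> and \<open>1/4\<close>.\<close>
  have "poly3 (\<lambda>z u v. 1 + u ^ 4 * ((1/4) * z + (1/4) * u + (-1/2) * (v * u ^ 2)))"
    by (intro poly3.intros poly3_power)
  moreover have "(\<lambda>z u v. 1 + u ^ 4 * ((1/4) * z + (1/4) * u + (-1/2) * (v * u ^ 2))) = pole_chart_u"
    by (simp add: fun_eq_iff pole_chart_u_def pole_chart_e_def)
  ultimately show "poly3 pole_chart_u" by simp
  have "poly3 (\<lambda>z u v. u * ((1/2) * z + u + (-3) * (v * u ^ 2)) * ((1/4) * z + (1/4) * u + (-1/2) * (v * u ^ 2)))"
    by (intro poly3.intros poly3_power)
  moreover have "(\<lambda>z u v. u * ((1/2) * z + u + (-3) * (v * u ^ 2)) * ((1/4) * z + (1/4) * u + (-1/2) * (v * u ^ 2))) = pole_chart_v"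
    by (simp add: fun_eq_iff pole_chart_v_def pole_chart_e_def)
  ultimately show "poly3 pole_chart_v" by simp
qed

lemma pole_chart_regular:
  assumes u: "(u has_field_derivative pole_chart_u z (u z) (v z)) (at z)"
    and v: "(v has_field_derivative pole_chart_v z (u z) (v z)) (at z)"
    and nz: "u z \<noteq> 0"
  shows "painleve1_at (\<lambda>z. pole_chart_x z (u z) (v z)) (\<lambda>z. 1 / (u z)\<^sup>2) z"
proof -
  define a b e where "a = u z" and "b = v z" and "e = pole_chart_e z a b"
  have "((\<lambda>z. 1 / (u z)\<^sup>2) has_field_derivative - 2 / a ^ 3 * pole_chart_u z a b) (at z)"
    using nz by (auto intro!: derivative_eq_intros u simp: a_def b_def field_simps power2_eq_square power3_eq_cube)
  moreover have "- 2 / a ^ 3 * pole_chart_u z a b = pole_chart_x z a b"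
    using nz by (simp add: a_def [symmetric] pole_chart_x_def pole_chart_u_def pole_chart_e_def field_simps power2_eq_square power3_eq_cube power4_eq_xxxx)
  moreover have "((\<lambda>z. pole_chart_x z (u z) (v z)) has_field_derivative
      6 / a ^ 4 * pole_chart_u z a b - (a / 2 + z / 2 * pole_chart_u z a b) - a * pole_chart_u z a b
       + (pole_chart_v z a b * a ^ 3 + b * (3 * a\<^sup>2 * pole_chart_u z a b))) (at z)"
    unfolding pole_chart_x_def
    using nz by (auto intro!: derivative_eq_intros u v simp: a_def b_def field_simps power2_eq_square power3_eq_cube power4_eq_xxxx)
  moreover have "6 / a ^ 4 * pole_chart_u z a b - (a / 2 + z / 2 * pole_chart_u z a b) - a * pole_chart_u z a b
       + (pole_chart_v z a b * a ^ 3 + b * (3 * a\<^sup>2 * pole_chart_u z a b)) = 6 * (1 / a\<^sup>2)\<^sup>2 + z"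
    using nz by (simp add: a_def [symmetric] pole_chart_u_def pole_chart_v_def)
      (simp add: pole_chart_e_def field_simps power2_eq_square power3_eq_cube power4_eq_xxxx)
  ultimately show ?thesis by (simp add: painleve1_at_def a_def b_def)
qed

text \<open>Where \<open>u\<close> vanishes, \<open>pole_chart_u\<close> equals 1, so zeros of
  \<open>u\<close> are simple and isolated. There \<open>1 / u\<^sup>2\<close> and the chart
  expression for \<open>x\<close> have poles; elsewhere the chart gives a regular solution.\<close>

lemma pole_chart_mero_on:
  assumes "open U"
    and u: "\<And>z. z \<in> U \<Longrightarrow> (u has_field_derivative pole_chart_u z (u z) (v z)) (at z)"
    and v: "\<And>z. z \<in> U \<Longrightarrow> (v has_field_derivative pole_chart_v z (u z) (v z)) (at z)"
  shows "painleve1_mero_on U (\<lambda>z. pole_chart_x z (u z) (v z)) (\<lambda>z. 1 / (u z)\<^sup>2)" (is "painleve1_mero_on U ?X ?Y")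
  unfolding painleve1_mero_on_def
proof
  fix p assume p: "p \<in> U"
  have cu: "isCont u p" and cv: "isCont v p" using u[OF p] v[OF p] DERIV_isCont by blast+
  have nz: "\<forall>\<^sub>F z in at p. u z \<noteq> 0"
  proof (cases "u p = 0")
    case True
    then have "(u has_field_derivative 1) (at p)" using u[OF p] by (simp add: pole_chart_u_def)
    then have "((\<lambda>z. (u z - u p) / (z - p)) \<longlongrightarrow> 1) (at p)" by (simp add: has_field_derivative_iff)
    then have "\<forall>\<^sub>F z in at p. (u z - u p) / (z - p) \<noteq> 0" by (rule tendsto_imp_eventually_ne) simp
    then show ?thesis by eventually_elim (use True in auto)
  next
    case False
    then show ?thesis using cu by (simp add: isCont_def tendsto_imp_eventually_ne)
  qed
  moreover have "\<forall>\<^sub>F z in at p. z \<in> U" using p assms(1) by (simp add: eventually_at_in_open')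
  ultimately have "\<forall>\<^sub>F z in at p. painleve1_at ?X ?Y z"
    by eventually_elim (intro pole_chart_regular u v)
  then have 1: "\<exists>e>0. \<forall>z\<in>ball p e - {p}. painleve1_at ?X ?Y z"
    unfolding eventually_at by (force simp: dist_commute)
  have "painleve1_at ?X ?Y p \<or> painleve1_pole ?X ?Y p"
  proof (cases "u p = 0")
    case True
    have u0: "filterlim (\<lambda>z. u z ^ n) (at 0) (at p)" if "n > 0" for n
    proof -
      have "((\<lambda>z. u z ^ n) \<longlongrightarrow> u p ^ n) (at p)" using cu by (intro tendsto_intros) (simp add: isCont_def)
      then show ?thesis using True that nz by (auto simp: filterlim_at zero_power elim: eventually_mono)
    qed
    have "is_pole (\<lambda>z. 1 / (u z)\<^sup>2) p"
      by (rule is_pole_divide) (use u0[of 2] in auto)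
    moreover have "is_pole ?X p"
    proof -
      \<comment> \<open>This is \<open>pole_chart_x\<close> over the common denominator
        \<open>u ^ 3\<close>; the numerator tends to -2.\<close>
      have "is_pole (\<lambda>z. (- 2 - z * (u z) ^ 4 / 2 - (u z) ^ 5 / 2 + v z * (u z) ^ 6) / (u z) ^ 3) p"
        by (rule is_pole_divide) (use u0[of 3] cu cv True in \<open>auto intro!: continuous_intros\<close>)
      moreover have "\<forall>\<^sub>F z in at p. (- 2 - z * (u z) ^ 4 / 2 - (u z) ^ 5 / 2 + v z * (u z) ^ 6) / (u z) ^ 3 = ?X z"
        using nz by eventually_elim (simp add: pole_chart_x_def field_simps eval_nat_numeral)
      ultimately show ?thesis by (rule is_pole_transform[OF _ _ refl])
    qed
    ultimately show ?thesis using True by (simp add: painleve1_pole_def pole_chart_x_def)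
  next
    case False
    then show ?thesis using pole_chart_regular u v p by blast
  qed
  with 1 show "(\<exists>e>0. \<forall>z\<in>ball p e - {p}. painleve1_at ?X ?Y z) \<and> (painleve1_at ?X ?Y p \<or> painleve1_pole ?X ?Y p)" by blast
qed

text \<open>In terms of \<open>q = - x * u ^ 3 / 2\<close> the energy relation says that
  \<open>q\<^sup>2\<close> is 1 up to order \<open>u ^ 4\<close>. With the right branch
  \<open>q\<close> is near 1, and \<open>v\<close> is the remainder of \<open>q\<close> at order
  \<open>u ^ 6\<close>, bounded because the lower orders cancel. The threshold on
  \<open>norm y\<close> makes \<open>u\<close> small against \<open>R\<close> and
  \<open>C\<close>.\<close>

lemma pole_chart_bounded:
  assumes R: "norm z \<le> R" and C: "norm (energy z x y) \<le> C" and y: "norm y \<ge> (1 + R + C)\<^sup>2"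
  shows "\<exists>u v. u \<noteq> 0 \<and> norm u \<le> 1 \<and> norm v \<le> ((R + C + 1) * (R + 1) + 4 + C) / 2 \<and>
           y = 1 / u\<^sup>2 \<and> x = pole_chart_x z u v"
proof -
  define E where "E = energy z x y"
  have R0: "R \<ge> 0" and C0: "C \<ge> 0" using R C norm_ge_zero order_trans by blast+
  have y1: "norm y \<ge> 1" using y R0 C0 one_le_power[of "1 + R + C" 2] by linarith
  then have ynz: "y \<noteq> 0" by auto
  define w where "w = 1 / csqrt y"
  \<comment> \<open>The sign of the square root selects the branch \<open>x \<approx> - 2 / u\<^sup>3\<close>, that is \<open>q \<approx> 1\<close> rather than \<open>q \<approx> - 1\<close>.\<close>
  define u where "u = (if Re (- x * w ^ 3 / 2) \<ge> 0 then w else - w)"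
  define q where "q = - x * u ^ 3 / 2"
  have unz: "u \<noteq> 0" using ynz by (simp add: u_def w_def)
  have u2: "u\<^sup>2 = 1 / y" by (simp add: u_def w_def power_divide)
  then have y_eq: "y = 1 / u\<^sup>2" using unz by (simp add: field_simps)
  have x_eq: "x = - 2 * q / u ^ 3" using unz by (simp add: q_def)
  have "q = (if Re (- x * w ^ 3 / 2) \<ge> 0 then - x * w ^ 3 / 2 else - (- x * w ^ 3 / 2))"
    by (simp add: q_def u_def)
  then have q0: "Re q \<ge> 0" by (smt (verit) uminus_complex.simps(1))
  define a where "a = norm u"
  have a0: "a > 0" using unz by (simp add: a_def)
  have a2: "a\<^sup>2 * norm y = 1" using u2 ynz by (simp add: a_def norm_divide flip: norm_power)
  have aR: "a * (1 + R + C) \<le> 1"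
  proof -
    have "(a * (1 + R + C))\<^sup>2 \<le> a\<^sup>2 * norm y" using y by (simp add: power_mult_distrib mult_left_mono)
    then show ?thesis using a2 R0 C0 a0 by (simp add: abs_square_le_1)
  qed
  have a1: "a \<le> 1" using aR R0 C0 a0 by (smt (verit) mult_le_cancel_left1)
  \<comment> \<open>The smoothed term of the energy is \<open>x / y * k\<close>. The error
    \<open>k' = 1 - k\<close> of the smoothing is of order \<open>u ^ 4\<close>, too small to
    disturb \<open>v\<close>.\<close>
  define k where "k = y * cnj y / (1 + y * cnj y)"
  define k' where "k' = 1 / (1 + y * cnj y)"
  have kk: "k + k' = 1" using one_plus_mult_cnj_nonzero[of y] by (simp add: k_def k'_def add_divide_distrib[symmetric] add.commute)
  have nk: "norm k \<le> 1" unfolding k_def norm_divide norm_one_plus_mult_cnj by (simp add: norm_mult power2_eq_square[symmetric] divide_le_eq add_pos_nonneg)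
  have nk': "norm k' \<le> a ^ 4"
  proof -
    have "(1 + (norm y)\<^sup>2) * a ^ 4 \<ge> (norm y * a\<^sup>2)\<^sup>2" by (simp add: algebra_simps power_mult_distrib)
    then show ?thesis unfolding k'_def norm_divide norm_one_plus_mult_cnj using a2 by (simp add: mult.commute divide_le_eq add_pos_nonneg)
  qed
  have "x\<^sup>2 - 4 * y ^ 3 - 2 * z * y + x / y * k = E"
    unfolding E_def energy_def k_def using ynz by simp
  then have "4 * q\<^sup>2 / u ^ 6 - 4 / u ^ 6 - 2 * z / u\<^sup>2 - 2 * q / u * k = E"
    unfolding x_eq y_eq using unz by (simp add: power_divide eval_nat_numeral field_simps)
  moreover have "q\<^sup>2 - (1 + (z * u ^ 4 / 2 + E * u ^ 6 / 4 + q * u ^ 5 * k / 2)) =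
      u ^ 6 / 4 * (4 * q\<^sup>2 / u ^ 6 - 4 / u ^ 6 - 2 * z / u\<^sup>2 - 2 * q / u * k - E)"
    using unz by (simp add: field_simps eval_nat_numeral)
  ultimately have q2: "q\<^sup>2 = 1 + (z * u ^ 4 / 2 + E * u ^ 6 / 4 + q * u ^ 5 * k / 2)"
    by simp
  have nE: "norm E \<le> C" using C by (simp add: E_def)
  have pow: "a ^ m \<le> a ^ n" if "n \<le> m" for m n using that a0 a1 by (simp add: power_decreasing)
  have t1: "norm (z * u ^ 4 / 2) \<le> R / 2 * a ^ 4"
    using R by (simp add: norm_mult norm_power a_def[symmetric] mult_right_mono)
  have t2: "norm (E * u ^ 6 / 4) \<le> C / 4 * a ^ 4"
    using mult_mono[OF nE pow[of 4 6]] C0 a0 by (simp add: norm_mult norm_power a_def[symmetric])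
  have t3: "norm (q * u ^ 5 * k / 2) \<le> norm q / 2 * a ^ 5"
    using mult_left_mono[OF nk, of "norm q * a ^ 5"] a0 by (simp add: norm_mult norm_power a_def[symmetric])
  have t: "norm (z * u ^ 4 / 2 + E * u ^ 6 / 4 + q * u ^ 5 * k / 2) \<le> R / 2 * a ^ 4 + C / 4 * a ^ 4 + norm q / 2 * a ^ 5"
    by (intro order_trans[OF norm_triangle_ineq] add_mono t1 t2 t3)
  \<comment> \<open>The relation for \<open>q\<^sup>2\<close> contains \<open>q\<close> on both
    sides; it is first used crudely, since \<open>norm q > 2\<close> would contradict
    \<open>(norm q)\<^sup>2 \<le> 2 + norm q / 2\<close>.\<close>
  have q_le: "norm q \<le> 2"
  proof (rule ccontr)
    assume "\<not> norm q \<le> 2"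
    then have q: "norm q > 2" by simp
    have "a ^ 4 \<le> a" "a ^ 5 \<le> 1" using pow[of 1 4] pow[of 0 5] by auto
    then have "R / 2 * a ^ 4 + C / 4 * a ^ 4 + norm q / 2 * a ^ 5 \<le> R * a + C * a + norm q / 2 * 1"
      using R0 C0 a0 by (intro add_mono mult_mono) auto
    also have "\<dots> \<le> 1 + norm q / 2" using aR a0 by (simp add: algebra_simps)
    finally have "(norm q)\<^sup>2 \<le> 2 + norm q / 2"
      using norm_triangle_ineq[of 1 "z * u ^ 4 / 2 + E * u ^ 6 / 4 + q * u ^ 5 * k / 2"] t
      unfolding norm_power[symmetric] q2 by simp
    moreover have "(norm q)\<^sup>2 > 2 * norm q" 
      unfolding power2_eq_square using q by (intro mult_strict_right_mono) auto
    ultimately show False using q by linarith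
  qed
  \<comment> \<open>This is what the choice of branch is for: \<open>q\<^sup>2 - 1\<close> can be
    divided by \<open>q + 1\<close> without loss.\<close>
  have qp: "norm (q + 1) \<ge> 1" using q0 complex_Re_le_cmod[of "q + 1"] by simp
  then have qp0: "q + 1 \<noteq> 0" by auto
  have q1: "norm (q - 1) \<le> (R + C + 1) * a ^ 4"
  proof -
    have "(q - 1) * (q + 1) = z * u ^ 4 / 2 + E * u ^ 6 / 4 + q * u ^ 5 * k / 2"
      using q2 by (simp add: algebra_simps power2_eq_square)
    then have "norm (q - 1) * norm (q + 1) \<le> R / 2 * a ^ 4 + C / 4 * a ^ 4 + norm q / 2 * a ^ 5"
      using t by (simp add: norm_mult[symmetric])
    moreover have "norm (q - 1) \<le> norm (q - 1) * norm (q + 1)" using qp by (simp add: mult_le_cancel_left1)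
    moreover have "norm q / 2 * a ^ 5 \<le> 1 * a ^ 4" using q_le pow[of 4 5] a0 by (intro mult_mono) auto
    moreover have "R / 2 * a ^ 4 \<le> R * a ^ 4" "C / 4 * a ^ 4 \<le> C * a ^ 4" using R0 C0 a0 by (auto intro!: mult_right_mono)
    ultimately show ?thesis by (simp add: algebra_simps)
  qed
  \<comment> \<open>Obtained by solving \<open>x = pole_chart_x z u v\<close> for
    \<open>v\<close>.\<close>
  define v where "v = 2 * (1 + z * u ^ 4 / 4 + u ^ 5 / 4 - q) / u ^ 6"
  have x_chart: "x = pole_chart_x z u v"
    unfolding x_eq pole_chart_x_def v_def using unz by (simp add: field_simps eval_nat_numeral)
  \<comment> \<open>Multiplication by \<open>q + 1\<close> brings in \<open>q\<^sup>2 - 1\<close>,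
    which the energy relation replaces. Orders \<open>u ^ 4\<close> and \<open>u ^ 5\<close> cancel
    up to factors \<open>q - 1\<close> and \<open>k'\<close>, so every remaining term has order at
    least \<open>u ^ 6\<close>.\<close>
  have "(q + 1) * (2 * v * u ^ 6) = (q - 1) * (z * u ^ 4 - u ^ 5) + 2 * q * u ^ 5 * k' - E * u ^ 6"
  proof -
    have "2 * v * u ^ 6 = 4 + z * u ^ 4 + u ^ 5 - 4 * q" unfolding v_def using unz by simp
    then have "(q + 1) * (2 * v * u ^ 6) = (q + 1) * (4 + z * u ^ 4 + u ^ 5 - 4 * q)"
      by (simp only:)
    also have "\<dots> = (q + 1) * (z * u ^ 4 + u ^ 5) - 4 * (q\<^sup>2 - 1)"
      by (simp add: algebra_simps power2_eq_square)
    also have "\<dots> = (q - 1) * (z * u ^ 4 - u ^ 5) + 2 * q * u ^ 5 * (1 - k) - E * u ^ 6"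
      unfolding q2 by (simp add: algebra_simps)
    also have "1 - k = k'" using kk by (simp add: algebra_simps)
    finally show ?thesis .
  qed
  then have "norm (q + 1) * (2 * norm v * a ^ 6) = norm ((q - 1) * (z * u ^ 4 - u ^ 5) + 2 * q * u ^ 5 * k' - E * u ^ 6)"
    by (metis a_def norm_mult norm_numeral norm_power)
  also have "\<dots> \<le> norm ((q - 1) * (z * u ^ 4 - u ^ 5)) + norm (2 * q * u ^ 5 * k') + norm (E * u ^ 6)"
    by (intro order_trans[OF norm_triangle_ineq4] order_trans[OF norm_triangle_ineq] add_mono order_refl)
  also have "\<dots> \<le> ((R + C + 1) * a ^ 4) * ((R + 1) * a ^ 4) + 4 * a ^ 9 + C * a ^ 6"
  proof (intro add_mono)
    have "norm (z * u ^ 4 - u ^ 5) \<le> R * a ^ 4 + a ^ 4"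
      using R pow[of 4 5] by (intro order_trans[OF norm_triangle_ineq4] add_mono) (simp_all add: norm_mult norm_power a_def[symmetric] mult_right_mono)
    then show "norm ((q - 1) * (z * u ^ 4 - u ^ 5)) \<le> ((R + C + 1) * a ^ 4) * ((R + 1) * a ^ 4)"
      unfolding norm_mult using q1 R0 C0 a0 by (intro mult_mono) (auto simp: algebra_simps)
    have "norm q * (norm k' * a ^ 5) \<le> 2 * (a ^ 4 * a ^ 5)" using q_le nk' a0 by (intro mult_mono) auto
    then show "norm (2 * q * u ^ 5 * k') \<le> 4 * a ^ 9"
      by (simp add: norm_mult norm_power a_def[symmetric] mult_ac flip: power_add)
    show "norm (E * u ^ 6) \<le> C * a ^ 6" using nE by (simp add: norm_mult norm_power a_def[symmetric] mult_right_mono)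
  qed
  also have "\<dots> \<le> (R + C + 1) * (R + 1) * a ^ 6 + 4 * a ^ 6 + C * a ^ 6"
  proof -
    have "(R + C + 1) * (R + 1) * a ^ 8 \<le> (R + C + 1) * (R + 1) * a ^ 6"
      using pow[of 6 8] R0 C0 by (intro mult_left_mono) auto
    moreover have "((R + C + 1) * a ^ 4) * ((R + 1) * a ^ 4) = (R + C + 1) * (R + 1) * a ^ 8"
      by (simp add: mult_ac flip: power_add)
    ultimately show ?thesis using pow[of 6 9] by linarith
  qed
  finally have le: "norm (q + 1) * (2 * norm v * a ^ 6) \<le> ((R + C + 1) * (R + 1) + 4 + C) * a ^ 6"
    by (simp add: algebra_simps)
  have "1 * (2 * norm v * a ^ 6) \<le> norm (q + 1) * (2 * norm v * a ^ 6)"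
    using qp a0 by (intro mult_right_mono) auto
  then have "(2 * norm v) * a ^ 6 \<le> ((R + C + 1) * (R + 1) + 4 + C) * a ^ 6" using le by linarith
  then have "2 * norm v \<le> (R + C + 1) * (R + 1) + 4 + C"
    using a0 by (simp add: mult_le_cancel_right)
  then show ?thesis using unz a1 y_eq x_chart unfolding a_def by (intro exI[of _ u] exI[of _ v]) auto
qed

subsection \<open>Continuation with uniform radius\<close>

text \<open>Solving the energy for \<open>x\<^sup>2\<close> leaves one term with \<open>x\<close>,
  and that is at most \<open>norm x\<close> because
  \<open>norm y \<le> 1 + (norm y)\<^sup>2\<close>. A quadratic inequality for \<open>norm x\<close>
  results.\<close>

lemma bounded_state_regular:
  assumes R: "norm z \<le> R" and C: "norm (energy z x y) \<le> C" and y: "norm y \<le> K"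
  shows "norm x \<le> 2 * C + 8 * K ^ 3 + 4 * R * K + 2"
proof -
  have K: "K \<ge> 0" and R0: "R \<ge> 0" using R y norm_ge_zero order_trans by blast+
  have "x\<^sup>2 = energy z x y + 4 * y ^ 3 + 2 * z * y - x * cnj y / (1 + y * cnj y)"
    by (simp add: energy_def)
  then have "(norm x)\<^sup>2 = norm (energy z x y + 4 * y ^ 3 + 2 * z * y - x * cnj y / (1 + y * cnj y))"
    by (metis norm_power)
  also have "\<dots> \<le> norm (energy z x y) + norm (4 * y ^ 3) + norm (2 * z * y) + norm (x * cnj y / (1 + y * cnj y))"
    by (intro order_trans[OF norm_triangle_ineq4] order_trans[OF norm_triangle_ineq] add_mono order_refl)
  also have "\<dots> \<le> C + 4 * K ^ 3 + 2 * R * K + norm x"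
  proof (intro add_mono C)
    show "norm (4 * y ^ 3) \<le> 4 * K ^ 3" using y by (simp add: norm_mult norm_power power_mono)
    show "norm (2 * z * y) \<le> 2 * R * K" using R y R0 by (simp add: norm_mult mult_mono)
    have "norm y / (1 + (norm y)\<^sup>2) \<le> 1"
      using sum_squares_bound[of "norm y" 1] norm_ge_zero[of y]
      by (simp add: divide_le_eq add_pos_nonneg del: norm_ge_zero)
    then have "norm x * (norm y / (1 + (norm y)\<^sup>2)) \<le> norm x * 1" by (intro mult_left_mono) auto
    then show "norm (x * cnj y / (1 + y * cnj y)) \<le> norm x"
      unfolding norm_divide norm_one_plus_mult_cnj by (simp add: norm_mult)
  qed
  finally have "(norm x)\<^sup>2 \<le> C + 4 * K ^ 3 + 2 * R * K + norm x" .
  moreover have "2 * norm x \<le> 1 + (norm x)\<^sup>2" using sum_squares_bound[of "norm x" 1] by simp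
  moreover have "4 * norm x \<le> 4 + (norm x)\<^sup>2" using sum_squares_bound[of "norm x" 2] by simp
  moreover have "C \<ge> 0" using C norm_ge_zero order_trans by blast
  moreover have "K ^ 3 \<ge> 0" "R * K \<ge> 0" using K R0 by auto
  ultimately show ?thesis by linarith
qed

text \<open>Data of bounded energy fall into two classes with bounded coordinates:
  \<open>(x, y)\<close> itself for moderate \<open>y\<close>, the pole chart for large
  \<open>y\<close>. Each system has a uniform existence radius, and the smaller one serves
  both.\<close>

lemma uniform_continuation:
  fixes R C :: real
  shows "\<exists>\<epsilon>>0. \<forall>c x y. norm c \<le> R \<and> norm (energy c x y) \<le> C \<longrightarrow>
    (\<exists>X Y. painleve1_mero_on (ball c \<epsilon>) X Y \<and> painleve1_at X Y c \<and> X c = x \<and> Y c = y)"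
proof -
  define K where "K = (1 + R + C)\<^sup>2"
  \<comment> \<open>\<open>K\<close> is the threshold of the pole chart. Sums with absolute values
    make \<open>M\<close> and \<open>N\<close> dominate all three data of the respective system at
    once.\<close>
  define M where "M = R + K + \<bar>2 * C + 8 * K ^ 3 + 4 * R * K + 2\<bar>"
  define N where "N = R + 1 + \<bar>((R + C + 1) * (R + 1) + 4 + C) / 2\<bar>"
  have K0: "K \<ge> 0" by (simp add: K_def)
  have "poly3 (\<lambda>z x y. 6 * y ^ 2 + z)" "poly3 (\<lambda>z x y. x)"
    by (intro poly3.intros poly3_power)+
  from polynomial_ode_uniform_existence[OF this, of M] obtain \<delta>1 where \<delta>1: "\<delta>1 > 0"
    and ex1: "\<And>c x0 y0 :: complex. norm c \<le> M \<and> norm x0 \<le> M \<and> norm y0 \<le> M \<Longrightarrow> \<exists>x y. x c = x0 \<and> y c = y0 \<and>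
      (\<forall>z\<in>ball c \<delta>1. (x has_field_derivative 6 * (y z)\<^sup>2 + z) (at z) \<and> (y has_field_derivative x z) (at z))"
    by blast
  from polynomial_ode_uniform_existence[OF poly3_pole_chart, of N] obtain \<delta>2 where \<delta>2: "\<delta>2 > 0"
    and ex2: "\<And>c u0 v0 :: complex. norm c \<le> N \<and> norm u0 \<le> N \<and> norm v0 \<le> N \<Longrightarrow> \<exists>u v. u c = u0 \<and> v c = v0 \<and>
      (\<forall>z\<in>ball c \<delta>2. (u has_field_derivative pole_chart_u z (u z) (v z)) (at z) \<and>
         (v has_field_derivative pole_chart_v z (u z) (v z)) (at z))"
    by blast
  show ?thesis
  proof (intro exI[of _ "min \<delta>1 \<delta>2"] conjI allI impI)
    fix c x y assume cxy: "norm c \<le> R \<and> norm (energy c x y) \<le> C"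
    have R0: "R \<ge> 0" using cxy norm_ge_zero order_trans by blast
    show "\<exists>X Y. painleve1_mero_on (ball c (min \<delta>1 \<delta>2)) X Y \<and> painleve1_at X Y c \<and> X c = x \<and> Y c = y"
    proof (cases "norm y \<le> K")
      case True
      have "norm c \<le> M \<and> norm x \<le> M \<and> norm y \<le> M"
        using cxy bounded_state_regular[OF conjunct1[OF cxy] conjunct2[OF cxy] True] True K0 R0 unfolding M_def by linarith
      from ex1[OF this] obtain X Y where XY: "X c = x" "Y c = y"
        "\<And>z. z \<in> ball c \<delta>1 \<Longrightarrow> painleve1_at X Y z"
        unfolding painleve1_at_def by blast
      moreover have "painleve1_mero_on (ball c (min \<delta>1 \<delta>2)) X Y"
        using XY(3) by (intro painleve1_mero_onI_at) auto
      ultimately show ?thesis using \<delta>1 by (metis centre_in_ball)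
    next
      case False
      then have "(1 + R + C)\<^sup>2 \<le> norm y" by (simp add: K_def)
      from pole_chart_bounded[OF conjunct1[OF cxy] conjunct2[OF cxy] this] obtain u0 v0 where
        uv0: "u0 \<noteq> 0" "norm u0 \<le> 1" "norm v0 \<le> ((R + C + 1) * (R + 1) + 4 + C) / 2"
          "y = 1 / u0\<^sup>2" "x = pole_chart_x c u0 v0" by blast
      have "norm c \<le> N \<and> norm u0 \<le> N \<and> norm v0 \<le> N" using cxy uv0(2,3) R0 unfolding N_def by linarith
      from ex2[OF this] obtain u v where uv: "u c = u0" "v c = v0"
        "\<And>z. z \<in> ball c \<delta>2 \<Longrightarrow> (u has_field_derivative pole_chart_u z (u z) (v z)) (at z)"
        "\<And>z. z \<in> ball c \<delta>2 \<Longrightarrow> (v has_field_derivative pole_chart_v z (u z) (v z)) (at z)" by blast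
      let ?X = "\<lambda>z. pole_chart_x z (u z) (v z)" and ?Y = "\<lambda>z. 1 / (u z)\<^sup>2"
      have "painleve1_mero_on (ball c (min \<delta>1 \<delta>2)) ?X ?Y"
        by (rule pole_chart_mero_on) (use uv in auto)
      moreover have "painleve1_at ?X ?Y c"
        by (rule pole_chart_regular) (use uv \<delta>2 uv0 in auto)
      ultimately show ?thesis using uv uv0 by (intro exI[of _ ?X] exI[of _ ?Y]) auto
    qed
  qed (use \<delta>1 \<delta>2 in auto)
qed

subsection \<open>Global continuation\<close>

text \<open>An accumulation point in \<open>K\<close> would contradict the regular punctured disc
  around it.\<close>

lemma painleve1_mero_on_finite_poles:
  assumes m: "painleve1_mero_on U X Y" and K: "compact K" "K \<subseteq> U"
  shows "finite {p\<in>K. \<not> painleve1_at X Y p}"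
proof (rule ccontr)
  assume "infinite {p\<in>K. \<not> painleve1_at X Y p}"
  then obtain p where p: "p \<in> K" "p islimpt {p\<in>K. \<not> painleve1_at X Y p}"
    using Heine_Borel_imp_Bolzano_Weierstrass[OF K(1)] by blast
  obtain e where e: "e > 0" "\<forall>z\<in>ball p e - {p}. painleve1_at X Y z"
    using p(1) K(2) m unfolding painleve1_mero_on_def by blast
  obtain q where "q \<in> {p\<in>K. \<not> painleve1_at X Y p}" "q \<noteq> p" "dist q p < e"
    using p(2) e(1) unfolding islimpt_approachable by blast
  then show False using e(2) by (auto simp: dist_commute)
qed

text \<open>A smaller closed disc contains finitely many poles, so they block finitely many radii,
  whereas the part of its circle near \<open>a\<close> has infinitely many points.\<close>

lemma radial_segment_avoiding_poles:
  assumes m: "painleve1_mero_on (ball z0 r) X Y" and at: "painleve1_at X Y z0"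
    and r: "r > 0" and a: "a \<in> sphere z0 r" and e: "e > 0"
  shows "\<exists>c\<in>ball z0 r. dist a c < e \<and> (\<forall>z\<in>closed_segment z0 c. painleve1_at X Y z)"
proof -
  \<comment> \<open>Shrinking by \<open>t\<close> moves \<open>a\<close> by less than
    \<open>e / 2\<close>, the other half being left for the choice of \<open>c\<close>; the maximum
    with 1/2 keeps the smaller radius positive.\<close>
  define t where "t = max (1/2) (1 - e / (4 * r))"
  have t: "0 < t" "t < 1" "(1 - t) * r < e / 2" using r e by (auto simp: t_def field_simps max_def)
  define \<rho> where "\<rho> = t * r"
  have \<rho>: "0 < \<rho>" "\<rho> < r" using t r by (auto simp: \<rho>_def)
  define b where "b = z0 + of_real t * (a - z0)"
  have na: "norm (a - z0) = r" using a by (simp add: dist_norm norm_minus_commute)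
  have b: "b \<in> sphere z0 \<rho>" using na t by (simp add: b_def \<rho>_def dist_norm norm_mult)
  have "a - b = of_real (1 - t) * (a - z0)" by (simp add: b_def algebra_simps)
  then have "dist a b = (1 - t) * r" using na t by (simp add: dist_norm norm_mult del: of_real_diff)
  then have ab: "dist a b < e / 2" using t(3) by simp
  have "b islimpt sphere z0 \<rho>"
  proof (rule connected_imp_perfect[OF _ b])
    fix x
    have "z0 + of_real \<rho> \<in> sphere z0 \<rho>" "z0 - of_real \<rho> \<in> sphere z0 \<rho>" using \<rho> by (auto simp: dist_norm)
    moreover have "z0 + of_real \<rho> \<noteq> z0 - of_real \<rho>"
    proof
      assume "z0 + of_real \<rho> = z0 - of_real \<rho>"
      then have "complex_of_real (2 * \<rho>) = 0" by (simp add: algebra_simps)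
      then show False using \<rho> by (simp only: of_real_eq_0_iff)
    qed
    ultimately show "sphere z0 \<rho> \<noteq> {x}" by (metis singletonD)
  qed (simp add: connected_sphere)
  then have inf: "infinite (sphere z0 \<rho> \<inter> ball b (e / 2))"
    using e unfolding islimpt_eq_infinite_ball by simp
  define Q where "Q = {p\<in>cball z0 \<rho>. \<not> painleve1_at X Y p}"
  have "finite Q" unfolding Q_def
    by (rule painleve1_mero_on_finite_poles[OF m compact_cball]) (use \<rho> in auto)
  \<comment> \<open>Central projection onto the smaller circle: a radius meets a pole only if it
    ends at the projection of that pole. The centre causes no division by zero, since it is regular
    and hence not in \<open>Q\<close>.\<close>
  define f where "f p = z0 + of_real (\<rho> / norm (p - z0)) * (p - z0)" for p
  have "finite (f ` Q)" using \<open>finite Q\<close> by simp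
  then have "sphere z0 \<rho> \<inter> ball b (e / 2) - f ` Q \<noteq> {}"
    using inf by (intro infinite_imp_nonempty Diff_infinite_finite)
  then obtain c where c: "c \<in> sphere z0 \<rho>" "c \<in> ball b (e / 2)" "c \<notin> f ` Q" by blast
  have nc: "norm (c - z0) = \<rho>" using c(1) by (simp add: dist_norm norm_minus_commute)
  have "painleve1_at X Y z" if z: "z \<in> closed_segment z0 c" for z
  proof (rule ccontr)
    assume n: "\<not> painleve1_at X Y z"
    obtain s where s: "0 \<le> s" "s \<le> 1" "z = z0 + of_real s * (c - z0)"
      using z unfolding closed_segment_def by (auto simp: scaleR_conv_of_real algebra_simps)
    have "s \<noteq> 0" using n at s by auto
    then have "s > 0" using s by simp
    have nz: "norm (z - z0) = s * \<rho>" using s nc by (simp add: norm_mult)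
    have "z \<in> Q" using n nz s \<rho> unfolding Q_def by (simp add: dist_norm norm_minus_commute mult_left_le_one_le)
    moreover have "f z = c" unfolding f_def nz using \<open>s > 0\<close> \<rho> s(3) by (simp add: field_simps)
    ultimately show False using c(3) by blast
  qed
  moreover have "c \<in> ball z0 r" using c(1) \<rho> by simp
  moreover have "dist a c < e" using ab c(2) dist_triangle[of a c b] by (simp add: dist_commute)
  ultimately show ?thesis by blast
qed

text \<open>Every boundary point is approached along pole-free radii on which the energy stays below
  one constant \<open>C\<close>. Uniform continuation from their endpoints yields discs of one
  radius that cover a neighbourhood of the boundary, and uniqueness glues them.\<close>

lemma painleve1_extend_ball:
  assumes r: "r > 0" and m: "painleve1_mero_on (ball z0 r) X Y" and at: "painleve1_at X Y z0"
  shows "\<exists>r'>r. \<exists>X' Y'. painleve1_mero_on (ball z0 r') X' Y' \<and> (\<forall>z\<in>ball z0 r. X' z = X z \<and> Y' z = Y z)"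
proof -
  define R where "R = norm z0 + r"
  \<comment> \<open>The growth estimate bounds \<open>1 + (norm E)\<^sup>2\<close> by
    \<open>C\<close>, and therefore \<open>norm E\<close> as well.\<close>
  define C where "C = (1 + (norm (energy z0 (X z0) (Y z0)))\<^sup>2) * exp (63 * (1 + R) * r)"
  have R0: "R \<ge> 0" using r by (simp add: R_def add_nonneg_nonneg)
  have R: "norm z \<le> R" if "z \<in> ball z0 r" for z
    using that norm_triangle_ineq2[of z z0] by (simp add: R_def dist_norm norm_minus_commute)
  obtain \<epsilon> where \<epsilon>: "\<epsilon> > 0" and ext: "\<And>c x y. norm c \<le> R \<Longrightarrow> norm (energy c x y) \<le> C \<Longrightarrow>
    \<exists>X Y. painleve1_mero_on (ball c \<epsilon>) X Y \<and> painleve1_at X Y c \<and> X c = x \<and> Y c = y"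
    using uniform_continuation[of R C] by blast
  \<comment> \<open>All continuations of radius \<open>\<epsilon>\<close> that match
    \<open>(X, Y)\<close> at a regular centre are collected; consistency comes from uniqueness, so
    no selection has to be made.\<close>
  define J where "J = {(V, X', Y'). \<exists>c\<in>ball z0 r. V = ball c \<epsilon> \<and> painleve1_mero_on (ball c \<epsilon>) X' Y' \<and>
     painleve1_at X' Y' c \<and> painleve1_at X Y c \<and> X c = X' c \<and> Y c = Y' c}"
  define I where "I = insert (ball z0 r, X, Y) J"
  define U where "U i = fst i" for i :: "complex set \<times> (complex \<Rightarrow> complex) \<times> (complex \<Rightarrow> complex)"
  define F where "F i = fst (snd i)" for i :: "complex set \<times> (complex \<Rightarrow> complex) \<times> (complex \<Rightarrow> complex)"
  define G where "G i = snd (snd i)" for i :: "complex set \<times> (complex \<Rightarrow> complex) \<times> (complex \<Rightarrow> complex)"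
  have reach: "\<exists>i\<in>J. a \<in> U i \<and> ball a (\<epsilon> / 2) \<subseteq> U i" if a: "a \<in> sphere z0 r" for a
  proof -
    obtain c where c: "c \<in> ball z0 r" "dist a c < \<epsilon> / 2" "\<And>z. z \<in> closed_segment z0 c \<Longrightarrow> painleve1_at X Y z"
      using radial_segment_avoiding_poles[OF m at r a, of "\<epsilon> / 2"] \<epsilon> by auto
    have seg: "closed_segment z0 c \<subseteq> ball z0 r" using c(1) r by (intro closed_segment_subset) auto
    have nc: "norm (c - z0) \<le> r" using c(1) by (simp add: dist_norm norm_minus_commute)
    define E where "E = energy c (X c) (Y c)"
    have "1 + (norm E)\<^sup>2 \<le> (1 + (norm (energy z0 (X z0) (Y z0)))\<^sup>2) * exp (63 * (1 + R) * norm (c - z0))"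
      unfolding E_def by (rule energy_growth[OF c(3)]) (use R seg in auto)
    also have "\<dots> \<le> C" unfolding C_def using nc R0 by (intro mult_left_mono) (auto simp: mult_left_mono)
    finally have "1 + (norm E)\<^sup>2 \<le> C" .
    moreover have "2 * norm E \<le> 1 + (norm E)\<^sup>2" using sum_squares_bound[of "norm E" 1] by simp
    ultimately have "norm E \<le> C" using norm_ge_zero[of E] by linarith
    then obtain X' Y' where "painleve1_mero_on (ball c \<epsilon>) X' Y'" "painleve1_at X' Y' c" "X' c = X c" "Y' c = Y c"
      using ext[OF R[OF c(1)], of "X c" "Y c"] unfolding E_def by blast
    then have "(ball c \<epsilon>, X', Y') \<in> J" unfolding J_def using c(1,3) by auto
    moreover have "ball a (\<epsilon> / 2) \<subseteq> ball c \<epsilon>"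
    proof
      fix z assume "z \<in> ball a (\<epsilon> / 2)"
      then show "z \<in> ball c \<epsilon>" using c(2) dist_triangle[of c z a] by (simp add: dist_commute)
    qed
    moreover have "a \<in> ball a (\<epsilon> / 2)" using \<epsilon> by simp
    ultimately show ?thesis unfolding U_def by (intro bexI[of _ "(ball c \<epsilon>, X', Y')"]) (auto simp del: mem_ball)
  qed
  have J: "\<exists>c\<in>ball z0 r. U i = ball c \<epsilon> \<and> painleve1_mero_on (ball c \<epsilon>) (F i) (G i) \<and>
     painleve1_at (F i) (G i) c \<and> painleve1_at X Y c \<and> X c = F i c \<and> Y c = G i c" if "i \<in> J" for i
    using that unfolding J_def U_def F_def G_def by auto
  have agree0: "X z = F i z \<and> Y z = G i z" if i: "i \<in> J" and z: "z \<in> ball z0 r" "z \<in> U i" for i z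
  proof -
    obtain c where c: "c \<in> ball z0 r" "U i = ball c \<epsilon>" "painleve1_mero_on (ball c \<epsilon>) (F i) (G i)"
     "painleve1_at (F i) (G i) c" "painleve1_at X Y c" "X c = F i c" "Y c = G i c" using J[OF i] by blast
    show ?thesis
    proof (rule painleve1_mero_on_unique[where U = "ball z0 r \<inter> ball c \<epsilon>" and c = c and z = z
          and X = X and Y = Y and X' = "F i" and Y' = "G i"])
      show "connected (ball z0 r \<inter> ball c \<epsilon>)" by (intro convex_connected convex_Int convex_ball)
      show "painleve1_mero_on (ball z0 r \<inter> ball c \<epsilon>) X Y" "painleve1_mero_on (ball z0 r \<inter> ball c \<epsilon>) (F i) (G i)"
        using m c(3) painleve1_mero_on_subset by blast+
    qed (use c z \<epsilon> in auto)
  qed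
  have agree1: "F i z = F j z \<and> G i z = G j z" if i: "i \<in> J" "j \<in> J" and z: "z \<in> U i" "z \<in> U j" for i j z
  proof -
    obtain c where c: "c \<in> ball z0 r" "U i = ball c \<epsilon>" "painleve1_mero_on (ball c \<epsilon>) (F i) (G i)" using J[OF i(1)] by blast
    obtain d where d: "d \<in> ball z0 r" "U j = ball d \<epsilon>" "painleve1_mero_on (ball d \<epsilon>) (F j) (G j)" using J[OF i(2)] by blast
    \<comment> \<open>Two equal balls that meet both contain the midpoint of their centres, which lies in the disc.\<close>
    define w where "w = midpoint c d"
    have "dist c d < 2 * \<epsilon>" using z c d dist_triangle[of c d z] by (simp add: dist_commute)
    then have w: "w \<in> ball c \<epsilon>" "w \<in> ball d \<epsilon>" unfolding w_def by (auto simp: dist_midpoint)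
    have "w \<in> closed_segment c d" unfolding w_def by simp
    then have w0: "w \<in> ball z0 r" using closed_segment_subset[OF c(1) d(1)] by auto
    show ?thesis
    proof (rule painleve1_mero_on_identity[where U = "ball c \<epsilon> \<inter> ball d \<epsilon>" and W = "ball z0 r \<inter> (ball c \<epsilon> \<inter> ball d \<epsilon>)"
          and c = w and z = z and X = "F i" and Y = "G i" and X' = "F j" and Y' = "G j"])
      show "connected (ball c \<epsilon> \<inter> ball d \<epsilon>)" by (intro convex_connected convex_Int convex_ball)
      show "painleve1_mero_on (ball c \<epsilon> \<inter> ball d \<epsilon>) (F i) (G i)" "painleve1_mero_on (ball c \<epsilon> \<inter> ball d \<epsilon>) (F j) (G j)"
        using c(3) d(3) painleve1_mero_on_subset by blast+
      fix v assume "v \<in> ball z0 r \<inter> (ball c \<epsilon> \<inter> ball d \<epsilon>)"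
      then show "F i v = F j v \<and> G i v = G j v"
        using agree0[OF i(1), of v] agree0[OF i(2), of v] c(2) d(2) by auto
    qed (use w w0 z c d in auto)
  qed
  obtain X' Y' where XY': "painleve1_mero_on (\<Union>i\<in>I. U i) X' Y'" "\<forall>i\<in>I. \<forall>z\<in>U i. X' z = F i z \<and> Y' z = G i z"
  proof -
    have "\<exists>X' Y'. painleve1_mero_on (\<Union>i\<in>I. U i) X' Y' \<and> (\<forall>i\<in>I. \<forall>z\<in>U i. X' z = F i z \<and> Y' z = G i z)"
    proof (rule painleve1_mero_on_Union)
      fix i assume i: "i \<in> I"
      show "open (U i)" using i J unfolding I_def U_def by fastforce
      show "painleve1_mero_on (U i) (F i) (G i)" using i J[of i] m unfolding I_def by (auto simp: U_def F_def G_def)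
      fix j z assume j: "j \<in> I" and z: "z \<in> U i" "z \<in> U j"
      have 0: "U (ball z0 r, X, Y) = ball z0 r" "F (ball z0 r, X, Y) = X" "G (ball z0 r, X, Y) = Y"
        by (simp_all add: U_def F_def G_def)
      consider "i \<in> J" "j \<in> J" | "i = (ball z0 r, X, Y)" "j \<in> J" | "i \<in> J" "j = (ball z0 r, X, Y)" | "i = j"
        using i j unfolding I_def by blast
      then show "F i z = F j z \<and> G i z = G j z"
      proof cases
        case 1 then show ?thesis using agree1 z by blast
      next
        case 2 then show ?thesis using agree0[of j z] z 0 by simp
      next
        case 3 then show ?thesis using agree0[of i z] z 0 by simp
      qed simp
    qed
    then show ?thesis using that by blast
  qed
  have "ball z0 (r + \<epsilon> / 2) \<subseteq> (\<Union>i\<in>I. U i)"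
  proof
    fix z assume z: "z \<in> ball z0 (r + \<epsilon> / 2)"
    show "z \<in> (\<Union>i\<in>I. U i)"
    proof (cases "z \<in> ball z0 r")
      case True
      then show ?thesis unfolding I_def U_def by auto
    next
      case False
      define n where "n = norm (z - z0)"
      have n: "r \<le> n" "n < r + \<epsilon> / 2" using z False by (auto simp: n_def dist_norm norm_minus_commute)
      \<comment> \<open>The radial projection of \<open>z\<close> is the nearest boundary point, at
        distance \<open>n - r < \<epsilon> / 2\<close>.\<close>
      define a where "a = z0 + of_real (r / n) * (z - z0)"
      have a: "a \<in> sphere z0 r" using n r by (simp add: a_def dist_norm norm_mult norm_divide flip: n_def)
      have "z - a = of_real (1 - r / n) * (z - z0)" by (simp add: a_def algebra_simps)
      then have "norm (z - a) = (1 - r / n) * n" using n r by (simp add: norm_mult n_def[symmetric] del: of_real_diff)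
      also have "\<dots> = n - r" using n r by (simp add: field_simps)
      finally have "z \<in> ball a (\<epsilon> / 2)" using n by (simp add: dist_norm norm_minus_commute)
      then show ?thesis using reach[OF a] unfolding I_def by blast
    qed
  qed
  then have "painleve1_mero_on (ball z0 (r + \<epsilon> / 2)) X' Y'" using XY'(1) painleve1_mero_on_subset by blast
  moreover have "\<forall>z\<in>ball z0 r. X' z = X z \<and> Y' z = Y z"
    using bspec[OF XY'(2), of "(ball z0 r, X, Y)"] by (simp add: I_def U_def F_def G_def)
  ultimately show ?thesis using \<epsilon> by (intro exI[of _ "r + \<epsilon> / 2"]) auto
qed

text \<open>Solutions on concentric discs with the same initial data agree by uniqueness and form
  one solution on the union. A finite supremum of their radii would be exceeded by extending that
  solution.\<close>

lemma painleve1_mero_on_UNIV_exists: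
  "\<exists>X Y. painleve1_mero_on UNIV X Y \<and> painleve1_at X Y z0 \<and> X z0 = x0 \<and> Y z0 = y0"
proof -
  define I where "I = {(r, X, Y). r > 0 \<and> painleve1_mero_on (ball z0 r) X Y \<and> painleve1_at X Y z0 \<and> X z0 = x0 \<and> Y z0 = y0}"
  define \<rho> where "\<rho> i = fst i" for i :: "real \<times> (complex \<Rightarrow> complex) \<times> (complex \<Rightarrow> complex)"
  define F where "F i = fst (snd i)" for i :: "real \<times> (complex \<Rightarrow> complex) \<times> (complex \<Rightarrow> complex)"
  define G where "G i = snd (snd i)" for i :: "real \<times> (complex \<Rightarrow> complex) \<times> (complex \<Rightarrow> complex)"
  have I: "\<rho> i > 0" "painleve1_mero_on (ball z0 (\<rho> i)) (F i) (G i)" "painleve1_at (F i) (G i) z0" "F i z0 = x0" "G i z0 = y0"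
    if "i \<in> I" for i using that by (auto simp: I_def \<rho>_def F_def G_def)
  have "\<exists>X' Y'. painleve1_mero_on (\<Union>i\<in>I. ball z0 (\<rho> i)) X' Y' \<and> (\<forall>i\<in>I. \<forall>z\<in>ball z0 (\<rho> i). X' z = F i z \<and> Y' z = G i z)"
  proof (rule painleve1_mero_on_Union)
    fix i j z assume ij: "i \<in> I" "j \<in> I" and z: "z \<in> ball z0 (\<rho> i)" "z \<in> ball z0 (\<rho> j)"
    show "F i z = F j z \<and> G i z = G j z"
    proof (rule painleve1_mero_on_unique[where U = "ball z0 (\<rho> i) \<inter> ball z0 (\<rho> j)" and c = z0 and z = z
          and X = "F i" and Y = "G i" and X' = "F j" and Y' = "G j"])
      show "connected (ball z0 (\<rho> i) \<inter> ball z0 (\<rho> j))" by (intro convex_connected convex_Int convex_ball)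
      show "painleve1_mero_on (ball z0 (\<rho> i) \<inter> ball z0 (\<rho> j)) (F i) (G i)"
        "painleve1_mero_on (ball z0 (\<rho> i) \<inter> ball z0 (\<rho> j)) (F j) (G j)"
        using I ij painleve1_mero_on_subset by blast+
    qed (use I ij z in auto)
  qed (use I in auto)
  then obtain X Y where XY: "painleve1_mero_on (\<Union>i\<in>I. ball z0 (\<rho> i)) X Y"
    and eq: "\<And>i z. i \<in> I \<Longrightarrow> z \<in> ball z0 (\<rho> i) \<Longrightarrow> X z = F i z \<and> Y z = G i z" by blast
  obtain i0 where i0: "i0 \<in> I"
  proof -
    obtain \<epsilon> X Y where "\<epsilon> > 0" "painleve1_mero_on (ball z0 \<epsilon>) X Y \<and> painleve1_at X Y z0 \<and> X z0 = x0 \<and> Y z0 = y0"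
      \<comment> \<open>With the bounds taken from the single initial datum, this is plain local
        existence.\<close>
      using uniform_continuation[of "norm z0" "norm (energy z0 x0 y0)"] by blast
    then have "(\<epsilon>, X, Y) \<in> I" by (simp add: I_def)
    then show ?thesis using that by blast
  qed
  have at: "painleve1_at X Y z0" "X z0 = x0" "Y z0 = y0"
    using painleve1_at_cong[of "ball z0 (\<rho> i0)" z0 X "F i0" Y "G i0"] eq[OF i0] I[OF i0] by auto
  have "\<not> bdd_above (\<rho> ` I)"
  proof
    assume bdd: "bdd_above (\<rho> ` I)"
    define s where "s = (SUP i\<in>I. \<rho> i)"
    have le: "\<rho> i \<le> s" if "i \<in> I" for i unfolding s_def using bdd that by (rule cSUP_upper2) simp
    then have "s > 0" using I(1)[OF i0] le[OF i0] by linarith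
    have "ball z0 s \<subseteq> (\<Union>i\<in>I. ball z0 (\<rho> i))"
    proof
      fix z assume "z \<in> ball z0 s"
      then have "dist z0 z < (SUP i\<in>I. \<rho> i)" by (simp add: s_def)
      moreover have "I \<noteq> {}" using i0 by blast
      ultimately obtain i where "i \<in> I" "dist z0 z < \<rho> i" using less_cSUP_iff[OF _ bdd] by blast
      then show "z \<in> (\<Union>i\<in>I. ball z0 (\<rho> i))" by auto
    qed
    then have "painleve1_mero_on (ball z0 s) X Y" using XY painleve1_mero_on_subset by blast
    from painleve1_extend_ball[OF \<open>s > 0\<close> this at(1)] obtain s' X' Y' where s': "s' > s"
      "painleve1_mero_on (ball z0 s') X' Y'" "\<And>z. z \<in> ball z0 s \<Longrightarrow> X' z = X z \<and> Y' z = Y z" by blast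
    then have "painleve1_at X' Y' z0 \<and> X' z0 = x0 \<and> Y' z0 = y0"
      using painleve1_at_cong[of "ball z0 s" z0 X' X Y' Y] at \<open>s > 0\<close> by simp
    then have "(s', X', Y') \<in> I" using s' \<open>s > 0\<close> by (simp add: I_def)
    then show False using le[of "(s', X', Y')"] s'(1) by (simp add: \<rho>_def)
  qed
  then have "\<exists>i\<in>I. dist z0 z < \<rho> i" for z
    unfolding bdd_above_def by (metis imageE not_le)
  then have "(\<Union>i\<in>I. ball z0 (\<rho> i)) = UNIV" by auto
  with XY at show ?thesis by auto
qed

text \<open>Every point has a punctured disc of holomorphy, and at the point itself there is either
  a finite limit or a pole; hence no singularity is essential.\<close>

lemma painleve1_mero_on_imp_meromorphic:
  assumes "painleve1_mero_on UNIV X Y"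
  shows "X meromorphic_on UNIV" "Y meromorphic_on UNIV"
proof -
  have "isolated_singularity_at X p \<and> not_essential X p \<and> isolated_singularity_at Y p \<and> not_essential Y p" for p
  proof -
    obtain e where e: "e > 0" "\<And>z. z \<in> ball p e - {p} \<Longrightarrow> painleve1_at X Y z"
      using assms unfolding painleve1_mero_on_def by blast
    have "X holomorphic_on ball p e - {p}" "Y holomorphic_on ball p e - {p}"
      using painleve1_at_imp_holomorphic_on[OF e(2)] by blast+
    then have "isolated_singularity_at X p" "isolated_singularity_at Y p"
      using e(1) by (auto intro!: isolated_singularity_at_holomorphic[of _ "ball p e"])
    moreover have "not_essential X p \<and> not_essential Y p"
    proof (cases "painleve1_at X Y p")
      case True
      then show ?thesis unfolding painleve1_at_def using DERIV_isCont isCont_def tendsto_imp_not_essential by blast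
    next
      case False
      then show ?thesis using assms unfolding painleve1_mero_on_def painleve1_pole_def by blast
    qed
    ultimately show ?thesis by blast
  qed
  then show "X meromorphic_on UNIV" "Y meromorphic_on UNIV"
    using meromorphic_at_iff meromorphic_on_meromorphic_at by blast+
qed

theorem theorem3p2:
  fixes z0 x0 y0 :: complex
  shows "\<exists>X Y. painleve1_meromorphic_solution X Y \<and>
           z0 \<in> regular_points X Y \<and> X z0 = x0 \<and> Y z0 = y0 \<and>
           (\<forall>U x y. open U \<and> connected U \<and> z0 \<in> U \<and>
              painleve1_solution_on U x y \<and> x z0 = x0 \<and> y z0 = y0 \<longrightarrow>
              (\<forall>z\<in>U. X z = x z \<and> Y z = y z))"
proof -
  obtain X Y where m: "painleve1_mero_on UNIV X Y" and at: "painleve1_at X Y z0" "X z0 = x0" "Y z0 = y0"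
    using painleve1_mero_on_UNIV_exists by blast
  \<comment> \<open>Differentiability excludes a pole, and by the alternative in
    \<open>painleve1_mero_on\<close> every other point is a pole of both functions.\<close>
  have reg: "regular_points X Y = {z. painleve1_at X Y z}"
    unfolding regular_points_def using m painleve1_at_imp_not_pole
    unfolding painleve1_mero_on_def painleve1_pole_def by blast
  have hol: "X holomorphic_on {z. painleve1_at X Y z}" "Y holomorphic_on {z. painleve1_at X Y z}"
    using painleve1_at_imp_holomorphic_on by blast+
  have sol: "painleve1_meromorphic_solution X Y"
    unfolding painleve1_meromorphic_solution_def painleve1_solution_on_def reg
    using painleve1_mero_on_imp_meromorphic[OF m] hol by (auto simp: painleve1_at_def)
  \<comment> \<open>A holomorphic solution on open \<open>U\<close> is a pole-free instance of
    \<open>painleve1_mero_on\<close>, so the uniqueness theorem covers it.\<close>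
  have uniq: "X z = x z \<and> Y z = y z"
    if U: "open U" "connected U" "z0 \<in> U" "painleve1_solution_on U x y" "x z0 = x0" "y z0 = y0" "z \<in> U" for U x y z
  proof (rule painleve1_mero_on_unique[OF U(1,2) _ _ U(3) at(1)])
    have p: "painleve1_at x y w" if "w \<in> U" for w
      using U(4) that unfolding painleve1_solution_on_def painleve1_at_def by blast
    then show "painleve1_mero_on U x y" "painleve1_at x y z0"
      using painleve1_mero_onI_at[OF U(1)] U(3) by blast+
    show "painleve1_mero_on U X Y" using m painleve1_mero_on_subset by blast
  qed (use at U in auto)
  show ?thesis
  proof (rule exI[of _ X], rule exI[of _ Y], intro conjI allI impI ballI)
    show "z0 \<in> regular_points X Y" using at(1) reg by simp
    fix U x y z
    assume U: "open U \<and> connected U \<and> z0 \<in> U \<and> painleve1_solution_on U x y \<and> x z0 = x0 \<and> y z0 = y0" "z \<in> U"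
    then show "X z = x z" "Y z = y z" using uniq[of U x y z] by simp_all
  qed (use sol at in simp_all)
qed

end
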